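(* Any quiver of finite type is totally proper; that is, for any quiver $Q$ of finite type there exists a cyclic ordering $\sigma$ of its vertices such that the cyclically ordered quiver $(Q,\sigma)$ is totally proper.
   Context: A quiver is a finite directed graph without loops or oriented 2-cycles; multiple arrows are allowed. Mutation $\mu_j$ of a quiver at a vertex $j$: for each path $i\to j\to k$ add an arrow $i\to k$; reverse all arrows incident to $j$; repeatedly remove oriented 2-cycles. Two quivers are mutation equivalent if they are related by a sequence of mutations. A quiver is of finite type if it is mutation equivalent to an orientation of a (disjoint union of) Dynkin diagram(s) of types $A_n$, $D_n$, $E_6,E_7,E_8$. A cyclic ordering $\sigma=(v_1,\dots,v_n)$ of the vertex set is a linear ordering considered up to cyclic shifts ("clockwise" placement on a circle). A cyclically ordered quiver (COQ) $(Q,\sigma)$ is a quiver with a cyclic ordering of its vertices. A wiggle transforms $(Q,\sigma)$ into $(Q,\sigma')$ where $\sigma'$ is obtained from $\sigma$ by interchanging two vertices that are consecutive in $\sigma$ and not adjacent in $Q$. Wiggle equivalence is the equivalence relation generated by wiggles. A path $i\to j\to k$ in $Q$ makes a right turn at $j$ if $\sigma=(\dots,i,\dots,j,\dots,k,\dots)$. A vertex $j$ is proper in $(Q,\sigma)$ if every oriented two-arrow path $i\to j\to k$ in $Q$ makes a right turn at $j$. A COQ $(Q,\sigma)$ is proper if for every vertex $j$ there is a COQ wiggle equivalent to $(Q,\sigma)$ (possibly depending on $j$) in which $j$ is proper. Let $\operatorname{In}(j)$ (resp., $\operatorname{Out}(j)$) be the set of vertices $i$ with an arrow $i\to j$ (resp.,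 $j\to i$) in $Q$. If $j$ is proper in $(Q,\sigma)$, the proper mutation $\mu_j(Q,\sigma)$ is the quiver $\mu_j(Q)$ with the cyclic ordering obtained from $\sigma$ by keeping the placement of all vertices other than $j$ and moving $j$ clockwise past all the vertices in $\operatorname{Out}(j)$ (each exactly once) without passing any vertex in $\operatorname{In}(j)$ (well defined up to wiggles; for a sink or source $j$ the cyclic ordering does not change, up to wiggles). The proper mutation class of a COQ consists of all COQs obtained from it by repeated proper mutations and wiggles. A COQ is totally proper if all COQs in its proper mutation class are proper. *)

theory Defs
  imports Main
begin

section \<open>Quivers and mutations\<close>

text \<open>A quiver is given by its vertices and the number of arrows between each ordered pair of
  vertices; the predicate \<open>quiver\<close> pins \<open>arr\<close> to 0 outside the vertex set, so that
  equality of records is equality of quivers with labelled vertices.\<close>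

record 'v quiver =
  verts :: "'v set"
  arr :: "'v \<Rightarrow> 'v \<Rightarrow> nat"

definition quiver :: "'v quiver \<Rightarrow> bool" where
  "quiver Q \<longleftrightarrow> finite (verts Q)
     \<and> (\<forall>i k. arr Q i k > 0 \<longrightarrow> i \<in> verts Q \<and> k \<in> verts Q)
     \<and> (\<forall>i. arr Q i i = 0)
     \<and> (\<forall>i k. arr Q i k = 0 \<or> arr Q k i = 0)"

definition In :: "'v quiver \<Rightarrow> 'v \<Rightarrow> 'v set" where
  "In Q j = {i. arr Q i j > 0}"

definition Out :: "'v quiver \<Rightarrow> 'v \<Rightarrow> 'v set" where
  "Out Q j = {k. arr Q j k > 0}"

definition compose_paths :: "'v \<Rightarrow> ('v \<Rightarrow> 'v \<Rightarrow> nat) \<Rightarrow> ('v \<Rightarrow> 'v \<Rightarrow> nat)" where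
  "compose_paths j a = (\<lambda>i k. a i k + a i j * a j k)"

definition reverse_at :: "'v \<Rightarrow> ('v \<Rightarrow> 'v \<Rightarrow> nat) \<Rightarrow> ('v \<Rightarrow> 'v \<Rightarrow> nat)" where
  "reverse_at j a = (\<lambda>i k. if i = j \<or> k = j then a k i else a i k)"

text \<open>Truncated subtraction: exactly \<open>min (a i k) (a k i)\<close> oriented 2-cycles are
  removed between \<open>i\<close> and \<open>k\<close>.\<close>

definition cancel_2cycles :: "('v \<Rightarrow> 'v \<Rightarrow> nat) \<Rightarrow> ('v \<Rightarrow> 'v \<Rightarrow> nat)" where
  "cancel_2cycles a = (\<lambda>i k. a i k - a k i)"

definition mutate :: "'v \<Rightarrow> 'v quiver \<Rightarrow> 'v quiver" where
  "mutate j Q = Q\<lparr>arr := cancel_2cycles (reverse_at j (compose_paths j (arr Q)))\<rparr>"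

definition mutation_step :: "'v quiver \<Rightarrow> 'v quiver \<Rightarrow> bool" where
  "mutation_step Q Q' \<longleftrightarrow> (\<exists>j\<in>verts Q. Q' = mutate j Q)"

definition mutation_equivalent :: "'v quiver \<Rightarrow> 'v quiver \<Rightarrow> bool" where
  "mutation_equivalent = mutation_step\<^sup>*\<^sup>*"


section \<open>Dynkin diagrams and finite type\<close>

datatype dynkin = TypeA nat | TypeD nat | TypeE nat

fun dynkin_type :: "dynkin \<Rightarrow> bool" where
  "dynkin_type (TypeA n) \<longleftrightarrow> n \<ge> 1"
| "dynkin_type (TypeD n) \<longleftrightarrow> n \<ge> 4"
| "dynkin_type (TypeE n) \<longleftrightarrow> n \<in> {6, 7, 8}"

fun rank :: "dynkin \<Rightarrow> nat" where
  "rank (TypeA n) = n"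
| "rank (TypeD n) = n"
| "rank (TypeE n) = n"

text \<open>The diagram has vertices \<open>0, \<dots>, n - 1\<close>. In types D and E the vertices
  \<open>0, \<dots>, n - 2\<close> form a path and \<open>n - 1\<close> is attached to the branch vertex, which
  leaves arms of lengths \<open>n - 3, 1, 1\<close> and \<open>2, n - 4, 1\<close> respectively.\<close>

fun dynkin_edges :: "dynkin \<Rightarrow> nat set set" where
  "dynkin_edges (TypeA n) = {{i, i + 1} | i. i + 1 < n}"
| "dynkin_edges (TypeD n) = {{i, i + 1} | i. i + 2 < n} \<union> {{n - 3, n - 1}}"
| "dynkin_edges (TypeE n) = {{i, i + 1} | i. i + 2 < n} \<union> {{2, n - 1}}"

text \<open>Disjoint union of a list of diagrams: vertex \<open>x\<close> of the \<open>c\<close>-th diagram becomes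
  \<open>(c, x)\<close>.\<close>

definition union_verts :: "dynkin list \<Rightarrow> (nat \<times> nat) set" where
  "union_verts ts = {(c, x). c < length ts \<and> x < rank (ts ! c)}"

definition union_edges :: "dynkin list \<Rightarrow> (nat \<times> nat) set set" where
  "union_edges ts = {Pair c ` e | c e. c < length ts \<and> e \<in> dynkin_edges (ts ! c)}"

definition dynkin_orientation :: "'v quiver \<Rightarrow> bool" where
  "dynkin_orientation Q \<longleftrightarrow> quiver Q \<and>
     (\<exists>ts f. (\<forall>t\<in>set ts. dynkin_type t) \<and> bij_betw f (verts Q) (union_verts ts) \<and>
       (\<forall>u\<in>verts Q. \<forall>v\<in>verts Q.
          arr Q u v + arr Q v u = (if {f u, f v} \<in> union_edges ts then 1 else 0)))"

definition finite_type :: "'v quiver \<Rightarrow> bool" where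
  "finite_type Q \<longleftrightarrow> quiver Q \<and> (\<exists>Q'. mutation_equivalent Q Q' \<and> dynkin_orientation Q')"


section \<open>Cyclically ordered quivers\<close>

text \<open>A cyclic ordering is represented by any of its linear orderings, listed clockwise. Two lists
  represent the same cyclic ordering iff they are rotations of one another; all notions below are
  invariant under rotation, and the equivalences and classes of COQs are closed under it.\<close>

type_synonym 'v coq = "'v quiver \<times> 'v list"

definition coq :: "'v coq \<Rightarrow> bool" where
  "coq = (\<lambda>(Q, \<sigma>). quiver Q \<and> distinct \<sigma> \<and> set \<sigma> = verts Q)"

definition same_coq :: "'v coq \<Rightarrow> 'v coq \<Rightarrow> bool" where
  "same_coq = (\<lambda>(Q, \<sigma>) (Q', \<sigma>'). Q' = Q \<and> (\<exists>n. \<sigma>' = rotate n \<sigma>))"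

definition wiggle :: "'v coq \<Rightarrow> 'v coq \<Rightarrow> bool" where
  "wiggle = (\<lambda>(Q, \<sigma>) (Q', \<sigma>'). Q' = Q \<and>
     (\<exists>n u v xs. rotate n \<sigma> = u # v # xs \<and> \<sigma>' = v # u # xs \<and>
        arr Q u v = 0 \<and> arr Q v u = 0))"

definition wiggle_equivalent :: "'v coq \<Rightarrow> 'v coq \<Rightarrow> bool" where
  "wiggle_equivalent = equivclp (sup same_coq wiggle)"

definition right_turn :: "'v list \<Rightarrow> 'v \<Rightarrow> 'v \<Rightarrow> 'v \<Rightarrow> bool" where
  "right_turn \<sigma> i j k \<longleftrightarrow>
     (\<exists>n as bs cs ds. rotate n \<sigma> = as @ [i] @ bs @ [j] @ cs @ [k] @ ds)"

definition proper_vertex :: "'v coq \<Rightarrow> 'v \<Rightarrow> bool" where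
  "proper_vertex = (\<lambda>(Q, \<sigma>) j. \<forall>i\<in>In Q j. \<forall>k\<in>Out Q j. right_turn \<sigma> i j k)"

definition proper_coq :: "'v coq \<Rightarrow> bool" where
  "proper_coq C \<longleftrightarrow> (\<forall>j\<in>verts (fst C). \<exists>C'. wiggle_equivalent C C' \<and> proper_vertex C' j)"

text \<open>A proper mutation is a relation because the new place of \<open>j\<close> is determined only up to
  wiggles: \<open>j\<close> moves clockwise past the segment \<open>xs\<close> following it, which contains all of
  \<open>Out Q j\<close> and avoids \<open>In Q j\<close>.\<close>

definition proper_mutation :: "'v \<Rightarrow> 'v coq \<Rightarrow> 'v coq \<Rightarrow> bool" where
  "proper_mutation j = (\<lambda>(Q, \<sigma>) (Q', \<sigma>'). j \<in> verts Q \<and> proper_vertex (Q, \<sigma>) j \<and>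
     Q' = mutate j Q \<and>
     (\<exists>n xs ys. rotate n \<sigma> = [j] @ xs @ ys \<and> \<sigma>' = xs @ [j] @ ys \<and>
        Out Q j \<subseteq> set xs \<and> In Q j \<inter> set xs = {}))"

definition coq_step :: "'v coq \<Rightarrow> 'v coq \<Rightarrow> bool" where
  "coq_step C C' \<longleftrightarrow> same_coq C C' \<or> wiggle C C' \<or> (\<exists>j. proper_mutation j C C')"

definition proper_mutation_class :: "'v coq \<Rightarrow> 'v coq set" where
  "proper_mutation_class C = {C'. coq_step\<^sup>*\<^sup>* C C'}"

definition totally_proper :: "'v coq \<Rightarrow> bool" where
  "totally_proper C \<longleftrightarrow> (\<forall>C'\<in>proper_mutation_class C. proper_coq C')"

end

theory Submission
  imports Defs
begin

text \<open>Let \<open>b u v\<close> be the signed number of arrows \<open>u \<rightarrow> v\<close>. Two properties of a COQ are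
  carried along proper mutations: the integral quadratic form
  \<open>\<Sum>\<^sub>u x\<^sub>u\<^sup>2 - \<Sum> b u v x\<^sub>u x\<^sub>v\<close> (second sum over \<open>u\<close> before \<open>v\<close> in the linear order) is positive
  definite, and every chordless cycle is oriented and met by \<open>\<sigma>\<close> in its cyclic order. Moving a cut
  changes the form by a sign and a proper mutation changes it by a transvection, so positivity
  persists and bounds arrow multiplicities by 1. The cycle condition makes a COQ proper: an
  obstruction to moving \<open>Out(j)\<close> before \<open>In(j)\<close> by wiggles is a chain of adjacent vertices that
  closes up at \<open>j\<close> to a badly wound chordless cycle. It survives a proper mutation because a new
  chordless cycle inherits the condition from an old one, unless all its arrows are increasing, in
  which case its indicator vector would be isotropic. A Dynkin quiver, ordered so that all arrows increase, has the Cartan form and no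
  cycles.\<close>

section \<open>The quadratic form of a linear order\<close>

text \<open>The form is that of a unitriangular matrix U with \<open>b\<close> = U^T - U. Its
  symmetrization U + U^T (\<open>gram\<close> below) has diagonal 2 and the entries of
  \<open>b\<close> up to sign elsewhere: a quasi-Cartan companion of \<open>b\<close> whose signs
  are dictated by the order. An oriented cycle wound once has exactly one arrow that goes down in
  the linear order, hence exactly one positive off-diagonal Gram entry along its edges; with none,
  its all-ones vector is isotropic. So the two conditions fit together, and the second records what
  wiggles can and cannot do. The ordering of an arbitrary \<open>Q\<close> of finite type is not
  written down directly. The invariant lets any chosen vertex become proper after wiggles, so every
  mutation can be carried out as a proper one. Thus the argument that yields properness also yields
  existence: an ordering of a Dynkin quiver is carried back to \<open>Q\<close> along the reversed
  mutation sequence.\<close>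

fun precedes :: "'a list \<Rightarrow> 'a \<Rightarrow> 'a \<Rightarrow> bool" where
  "precedes [] u v \<longleftrightarrow> False"
| "precedes (a # as) u v \<longleftrightarrow> u = a \<and> v \<in> set as \<or> precedes as u v"

lemma precedes_append:
  "precedes (xs @ ys) u v \<longleftrightarrow> precedes xs u v \<or> precedes ys u v \<or> u \<in> set xs \<and> v \<in> set ys"
  by (induction xs) auto

lemma precedes_in: "precedes xs u v \<Longrightarrow> u \<in> set xs \<and> v \<in> set xs"
  by (induction xs) auto

lemma precedes_asym: "distinct xs \<Longrightarrow> precedes xs u v \<Longrightarrow> \<not> precedes xs v u"
  by (induction xs) (auto dest: precedes_in)

lemma precedes_irrefl: "distinct xs \<Longrightarrow> \<not> precedes xs u u"
  using precedes_asym[of xs u u] by blast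

lemma precedes_trans: "distinct xs \<Longrightarrow> precedes xs u v \<Longrightarrow> precedes xs v w \<Longrightarrow> precedes xs u w"
  by (induction xs) (auto dest: precedes_in)

lemma precedes_total:
  "u \<in> set xs \<Longrightarrow> v \<in> set xs \<Longrightarrow> u \<noteq> v \<Longrightarrow> precedes xs u v \<or> precedes xs v u"
  by (induction xs) auto

section \<open>The quadratic form under a move of the cut and under mutation\<close>

definition skew :: "('v \<Rightarrow> 'v \<Rightarrow> int) \<Rightarrow> bool" where
  "skew b \<longleftrightarrow> (\<forall>u v. b u v = - b v u)"

lemma skewD: "skew b \<Longrightarrow> b u v = - b v u"
  unfolding skew_def by blast

lemma skew_diag: "skew b \<Longrightarrow> b u u = 0"
  using skewD[of b u u] by linarith

fun tits :: "('v \<Rightarrow> 'v \<Rightarrow> int) \<Rightarrow> 'v list \<Rightarrow> ('v \<Rightarrow> int) \<Rightarrow> int" where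
  "tits b [] x = 0"
| "tits b (u # us) x = (x u)\<^sup>2 - x u * (\<Sum>v\<leftarrow>us. b u v * x v) + tits b us x"

lemma tits_append:
  "tits b (us @ vs) x = tits b us x + tits b vs x - (\<Sum>u\<leftarrow>us. x u * (\<Sum>v\<leftarrow>vs. b u v * x v))"
  by (induction us) (simp_all add: algebra_simps)

lemma tits_cong:
  assumes "\<And>u. u \<in> set us \<Longrightarrow> x u = y u"
    and "\<And>u v. u \<in> set us \<Longrightarrow> v \<in> set us \<Longrightarrow> b u v = c u v"
  shows "tits b us x = tits c us y"
  using assms
proof (induction us)
  case (Cons u us)
  then have "(\<Sum>v\<leftarrow>us. b u v * x v) = (\<Sum>v\<leftarrow>us. c u v * y v)"
    by (intro arg_cong[where f = sum_list] map_cong) auto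
  with Cons show ?case by simp
qed simp

lemma tits_rotate1:
  assumes "skew b" and "u \<notin> set us"
  shows "tits b (us @ [u]) x = tits b (u # us) (x(u := - x u))"
proof -
  have "tits b us (x(u := - x u)) = tits b us x"
    using assms(2) by (intro tits_cong) auto
  moreover have "(\<Sum>v\<leftarrow>us. b u v * (x(u := - x u)) v) = (\<Sum>v\<leftarrow>us. - (b v u * x v))"
  proof (intro arg_cong[where f = sum_list] map_cong)
    fix v assume "v \<in> set us"
    then have "v \<noteq> u" using assms(2) by blast
    then show "b u v * (x(u := - x u)) v = - (b v u * x v)"
      by (simp add: skewD[OF assms(1), of u v])
  qed simp
  moreover have "(\<Sum>v\<leftarrow>us. x v * (b v u * x u)) = x u * (\<Sum>v\<leftarrow>us. b v u * x v)"
    by (induction us) (simp_all add: algebra_simps)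
  moreover have neg: "(\<Sum>v\<leftarrow>us. - (b v u * x v)) = - (\<Sum>v\<leftarrow>us. b v u * x v)"
    by (induction us) simp_all
  ultimately show ?thesis
    by (simp add: tits_append)
qed

definition positive :: "('v \<Rightarrow> 'v \<Rightarrow> int) \<Rightarrow> 'v list \<Rightarrow> bool" where
  "positive b \<sigma> \<longleftrightarrow> (\<forall>x. (\<exists>v\<in>set \<sigma>. x v \<noteq> 0) \<longrightarrow> tits b \<sigma> x > 0)"

lemma positive_rotate1:
  assumes "skew b" and "distinct \<sigma>" and "positive b \<sigma>"
  shows "positive b (rotate1 \<sigma>)"
proof (cases \<sigma>)
  case (Cons u us)
  have "tits b (us @ [u]) x > 0" if "\<exists>v\<in>set \<sigma>. x v \<noteq> 0" for x
  proof -
    have "\<exists>v\<in>set \<sigma>. (x(u := - x u)) v \<noteq> 0"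
      using that by auto
    then show ?thesis
      using assms Cons tits_rotate1[of b u us x] unfolding positive_def
      by (metis distinct.simps(2))
  qed
  then show ?thesis using Cons by (auto simp: positive_def)
qed (use assms in simp)

lemma positive_rotate:
  assumes "skew b" and "distinct \<sigma>" and "positive b \<sigma>"
  shows "positive b (rotate n \<sigma>)"
  by (induction n) (use assms in \<open>auto intro: positive_rotate1\<close>)

text \<open>The two products count the paths through \<open>j\<close> in either direction; taking
  their difference is the removal of 2-cycles.\<close>

definition mu :: "'v \<Rightarrow> ('v \<Rightarrow> 'v \<Rightarrow> int) \<Rightarrow> 'v \<Rightarrow> 'v \<Rightarrow> int" where
  "mu j b u v = (if u = j \<or> v = j then - b u v
     else b u v + max 0 (b u j) * max 0 (b j v) - max 0 (b v j) * max 0 (b j u))"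

lemma skew_mu: "skew b \<Longrightarrow> skew (mu j b)"
  unfolding skew_def mu_def by (smt (verit, best))

text \<open>Let \<open>e_v\<close> be the basis vectors. For \<open>i\<close> in \<open>ys\<close>
  the Gram entry of \<open>j\<close> and \<open>i\<close> is \<open>b i j\<close>, so the
  substitution replaces \<open>e_i\<close> by its reflection in \<open>e_j\<close> and keeps the
  other basis vectors. With the cut before \<open>j\<close>, all paths through \<open>j\<close> lead
  from \<open>ys\<close> to \<open>xs\<close>. Apart from the signs at \<open>j\<close>, only the
  entries between \<open>xs\<close> and \<open>ys\<close> change, and the reflection accounts for
  exactly this change.\<close>

lemma tits_mu:
  assumes b: "skew b" and d: "distinct (j # xs @ ys)"
    and xs: "\<And>v. v \<in> set xs \<Longrightarrow> b j v \<ge> 0" and ys: "\<And>v. v \<in> set ys \<Longrightarrow> b j v \<le> 0"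
  shows "tits (mu j b) (xs @ j # ys) x
    = tits b (j # xs @ ys) (x(j := x j - (\<Sum>i\<leftarrow>ys. b i j * x i)))"
proof -
  define N where "N = (\<Sum>i\<leftarrow>ys. b i j * x i)"
  define P where "P = (\<Sum>i\<leftarrow>xs. b j i * x i)"
  define C where "C = (\<Sum>u\<leftarrow>xs. x u * (\<Sum>v\<leftarrow>ys. b u v * x v))"
  let ?x = "x(j := x j - N)"
  have jxs: "j \<notin> set xs" and jys: "j \<notin> set ys"
    using d by auto
  have sk: "b u v = - b v u" for u v using skewD[OF b] .
  have 1: "tits (mu j b) xs x = tits b xs x"
    using jxs xs by (intro tits_cong) (auto simp: mu_def sk[of _ j])
  have 2: "tits (mu j b) ys x = tits b ys x"
    using jys ys by (intro tits_cong) (auto simp: mu_def sk[of _ j])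
  have 3: "(\<Sum>v\<leftarrow>ys. mu j b j v * x v) = N"
    unfolding N_def by (intro arg_cong[where f = sum_list] map_cong) (auto simp: mu_def sk[of _ j])
  have 4: "(\<Sum>u\<leftarrow>xs. x u * (\<Sum>v\<leftarrow>j # ys. mu j b u v * x v)) = P * x j + C - P * N"
  proof -
    have eq: "(\<Sum>v\<leftarrow>j # ys. mu j b u v * x v) = b j u * x j + (\<Sum>v\<leftarrow>ys. b u v * x v) - b j u * N"
      if u: "u \<in> set xs" for u
    proof -
      have "mu j b u v * x v = b u v * x v - b j u * (b v j * x v)" if v: "v \<in> set ys" for v
      proof -
        have "u \<noteq> j" "v \<noteq> j" using u v jxs jys by auto
        then show ?thesis
          using xs[OF u] ys[OF v] sk[of u j] sk[of v j] by (simp add: mu_def algebra_simps)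
      qed
      then have "(\<Sum>v\<leftarrow>ys. mu j b u v * x v) = (\<Sum>v\<leftarrow>ys. b u v * x v - b j u * (b v j * x v))"
        by (intro arg_cong[where f = sum_list] map_cong) auto
      then show ?thesis
        using jxs u by (simp add: mu_def sk[of u j] N_def sum_list_subtractf sum_list_const_mult)
    qed
    have "(\<Sum>u\<leftarrow>xs. x u * (\<Sum>v\<leftarrow>j # ys. mu j b u v * x v))
      = (\<Sum>u\<leftarrow>xs. b j u * x u * x j + x u * (\<Sum>v\<leftarrow>ys. b u v * x v) - b j u * x u * N)"
    proof (intro arg_cong[where f = sum_list] map_cong)
      fix u assume "u \<in> set xs"
      then show "x u * (\<Sum>v\<leftarrow>j # ys. mu j b u v * x v)
          = b j u * x u * x j + x u * (\<Sum>v\<leftarrow>ys. b u v * x v) - b j u * x u * N"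
        unfolding eq[OF \<open>u \<in> set xs\<close>] by (simp add: algebra_simps)
    qed simp
    also have "\<dots> = P * x j + C - P * N"
      by (simp add: sum_list_addf sum_list_subtractf P_def C_def sum_list_mult_const)
    finally show ?thesis .
  qed
  have 5: "tits b xs ?x = tits b xs x" "tits b ys ?x = tits b ys x"
    using jxs jys by (auto intro!: tits_cong)
  have 6: "(\<Sum>u\<leftarrow>xs. ?x u * (\<Sum>v\<leftarrow>ys. b u v * ?x v)) = C"
  proof -
    have "(\<Sum>v\<leftarrow>ys. b u v * ?x v) = (\<Sum>v\<leftarrow>ys. b u v * x v)" for u
      using jys by (intro arg_cong[where f = sum_list] map_cong) auto
    then show ?thesis
      unfolding C_def using jxs by (intro arg_cong[where f = sum_list] map_cong) auto
  qed
  have 7: "(\<Sum>v\<leftarrow>xs @ ys. b j v * ?x v) = P - N"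
  proof -
    have "(\<Sum>v\<leftarrow>xs. b j v * ?x v) = P"
      unfolding P_def using jxs by (intro arg_cong[where f = sum_list] map_cong) auto
    moreover have "(\<Sum>v\<leftarrow>ys. b j v * ?x v) = (\<Sum>v\<leftarrow>ys. - (b v j * x v))"
    proof (intro arg_cong[where f = sum_list] map_cong)
      fix v assume "v \<in> set ys"
      then have "v \<noteq> j" using jys by blast
      then show "b j v * ?x v = - (b v j * x v)"
        by (simp add: sk[of j v])
    qed simp
    moreover have "\<dots> = - N"
      unfolding N_def by (induction ys) simp_all
    ultimately show ?thesis by simp
  qed
  show ?thesis
    unfolding N_def[symmetric] tits_append tits.simps(2) 1 2 3 4 5 6 7
    by (simp add: power2_eq_square algebra_simps)
qed

lemma positive_mu:
  assumes "skew b" and "distinct (j # xs @ ys)"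
    and "\<And>v. v \<in> set xs \<Longrightarrow> b j v \<ge> 0" and "\<And>v. v \<in> set ys \<Longrightarrow> b j v \<le> 0"
    and pos: "positive b (j # xs @ ys)"
  shows "positive (mu j b) (xs @ j # ys)"
  unfolding positive_def
proof (intro allI impI)
  fix x :: "'a \<Rightarrow> int"
  assume ex: "\<exists>v\<in>set (xs @ j # ys). x v \<noteq> 0"
  define N where "N = (\<Sum>i\<leftarrow>ys. b i j * x i)"
  \<comment> \<open>The substitution is triangular: if the other coordinates vanish, so does
    \<open>N\<close>, and the coordinate of \<open>j\<close> is unchanged.\<close>
  have "\<exists>v\<in>set (j # xs @ ys). (x(j := x j - N)) v \<noteq> 0"
  proof (rule ccontr)
    assume "\<not> ?thesis"
    then have z: "\<forall>v\<in>set (j # xs @ ys). (x(j := x j - N)) v = 0"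
      by blast
    have 0: "x v = 0" if "v \<in> set (xs @ ys)" for v
      using z that assms(2) by (auto split: if_splits)
    have j: "x j = N"
      using z by simp
    have "N = (\<Sum>i\<leftarrow>ys. 0)"
      unfolding N_def using 0 by (intro arg_cong[where f = sum_list] map_cong) auto
    then have "x j = 0" using j by simp
    then show False using ex 0 by auto
  qed
  then show "tits (mu j b) (xs @ j # ys) x > 0"
    using pos tits_mu[OF assms(1-4), of x] unfolding positive_def N_def by presburger
qed

section \<open>The Gram matrix and arrow multiplicities\<close>

definition gram :: "('v \<Rightarrow> 'v \<Rightarrow> int) \<Rightarrow> 'v list \<Rightarrow> 'v \<Rightarrow> 'v \<Rightarrow> int" where
  "gram b \<sigma> u v = (if u = v then 2 else if precedes \<sigma> u v then - b u v else b u v)"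

lemma tits_gram:
  assumes "skew b" and "distinct \<sigma>"
  shows "2 * tits b \<sigma> x = (\<Sum>u\<in>set \<sigma>. \<Sum>v\<in>set \<sigma>. gram b \<sigma> u v * x u * x v)"
  using assms(2)
proof (induction \<sigma>)
  case (Cons a as)
  let ?S = "\<Sum>v\<in>set as. b a v * x v"
  have a: "a \<notin> set as" and d: "distinct as" using Cons by auto
  have "gram b (a # as) u v = gram b as u v" if "u \<in> set as" "v \<in> set as" for u v
    using that a by (auto simp: gram_def)
  then have 1: "(\<Sum>u\<in>set as. \<Sum>v\<in>set as. gram b (a # as) u v * x u * x v) = 2 * tits b as x"
    using Cons by (auto intro!: sum.cong)
  have "gram b (a # as) a v = - b a v" if "v \<in> set as" for v
    using that a by (auto simp: gram_def)
  then have 2: "(\<Sum>v\<in>set as. gram b (a # as) a v * x a * x v) = - x a * ?S"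
    by (simp add: sum_distrib_left sum_negf algebra_simps)
  have "gram b (a # as) v a = - b a v" if "v \<in> set as" for v
    using that a by (auto simp: gram_def skewD[OF assms(1), of v a] dest: precedes_in)
  then have 3: "(\<Sum>v\<in>set as. gram b (a # as) v a * x v * x a) = - x a * ?S"
    by (simp add: sum_distrib_left sum_negf algebra_simps)
  have 4: "gram b (a # as) a a = 2" by (simp add: gram_def)
  have 5: "(\<Sum>v\<leftarrow>as. b a v * x v) = ?S"
    using d by (simp add: sum_list_distinct_conv_sum_set)
  have "(\<Sum>u\<in>set (a # as). \<Sum>v\<in>set (a # as). gram b (a # as) u v * x u * x v)
    = 2 * x a * x a - x a * ?S + ((\<Sum>v\<in>set as. gram b (a # as) v a * x v * x a)
       + (\<Sum>u\<in>set as. \<Sum>v\<in>set as. gram b (a # as) u v * x u * x v))"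
    using a by (simp add: 2 4 sum.distrib)
  then show ?case
    unfolding 1 3 tits.simps 5 by (simp add: power2_eq_square algebra_simps)
qed simp

text \<open>Serves the two kinds of test vectors used later: one lives on a pair of vertices, the
  other on a cycle.\<close>

lemma tits_support:
  assumes "skew b" and "distinct \<sigma>" and "S \<subseteq> set \<sigma>" and "\<And>v. v \<notin> S \<Longrightarrow> x v = 0"
  shows "2 * tits b \<sigma> x = (\<Sum>u\<in>S. \<Sum>v\<in>S. gram b \<sigma> u v * x u * x v)"
proof -
  have "(\<Sum>v\<in>set \<sigma>. gram b \<sigma> u v * x u * x v) = (\<Sum>v\<in>S. gram b \<sigma> u v * x u * x v)" for u
    using assms by (intro sum.mono_neutral_right) auto
  moreover have "(\<Sum>u\<in>set \<sigma>. \<Sum>v\<in>S. gram b \<sigma> u v * x u * x v)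
     = (\<Sum>u\<in>S. \<Sum>v\<in>S. gram b \<sigma> u v * x u * x v)"
    using assms by (intro sum.mono_neutral_right) auto
  ultimately show ?thesis
    using tits_gram[OF assms(1,2), of x] by simp
qed

lemma positive_le_1:
  assumes b: "skew b" and d: "distinct \<sigma>" and pos: "positive b \<sigma>"
    and uv: "u \<in> set \<sigma>" "v \<in> set \<sigma>"
  shows "\<bar>b u v\<bar> \<le> 1"
proof (cases "u = v")
  case False
  have *: "(gram b \<sigma> u v) * s < 2" if s: "\<bar>s\<bar> = 1" for s
  proof -
    \<comment> \<open>The test vector is \<open>e_u - s * e_v\<close>; the two signs of
      \<open>s\<close> bound the entry from both sides.\<close>
    define x where "x = (\<lambda>w. if w = u then 1 else if w = v then - s else 0)"
    have "2 * tits b \<sigma> x = (\<Sum>a\<in>{u, v}. \<Sum>c\<in>{u, v}. gram b \<sigma> a c * x a * x c)"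
      using uv by (intro tits_support b d) (auto simp: x_def)
    also have "\<dots> = 4 - 2 * (gram b \<sigma> u v * s)"
    proof -
      have "gram b \<sigma> v u = gram b \<sigma> u v"
        using False uv precedes_asym[OF d, of u v] precedes_total[of u \<sigma> v] skewD[OF b, of u v]
        by (auto simp: gram_def)
      moreover have "s * s = 1"
        using s by (simp add: abs_if split: if_splits)
      ultimately show ?thesis
        using False by (simp add: x_def gram_def[of _ _ u u] gram_def[of _ _ v v])
    qed
    finally have "2 * tits b \<sigma> x = 4 - 2 * (gram b \<sigma> u v * s)" .
    moreover have "tits b \<sigma> x > 0"
      using pos uv unfolding positive_def by (metis x_def zero_neq_one)
    ultimately show ?thesis by linarith
  qed
  have "\<bar>gram b \<sigma> u v\<bar> \<le> 1"
    using *[of 1] *[of "-1"] by simp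
  then show ?thesis using False by (auto simp: gram_def split: if_splits)
qed (simp add: skew_diag[OF b])

section \<open>Chordless cycles\<close>

fun induced_path :: "('v \<Rightarrow> 'v \<Rightarrow> int) \<Rightarrow> 'v list \<Rightarrow> bool" where
  "induced_path b [] \<longleftrightarrow> True"
| "induced_path b (x # p) \<longleftrightarrow>
     x \<notin> set p \<and> (\<forall>y\<in>set p. b x y \<noteq> 0 \<longleftrightarrow> y = hd p) \<and> induced_path b p"

lemma induced_path_append:
  assumes "p \<noteq> []" and "q \<noteq> []"
  shows "induced_path b (p @ q) \<longleftrightarrow> induced_path b p \<and> induced_path b q \<and> set p \<inter> set q = {}
    \<and> (\<forall>u\<in>set p. \<forall>v\<in>set q. b u v \<noteq> 0 \<longleftrightarrow> u = last p \<and> v = hd q)"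
  using assms(1)
proof (induction p)
  case (Cons x p)
  show ?case
  proof (cases "p = []")
    case True
    then show ?thesis using assms(2) by auto
  next
    case False
    have "(\<forall>y\<in>set q. (b x y \<noteq> 0) = (y = hd p))
        \<longleftrightarrow> (\<forall>y\<in>set q. (b x y \<noteq> 0) = (x = last p \<and> y = hd q))"
      if "x \<notin> set p" "set p \<inter> set q = {}"
      using that hd_in_set[OF False] last_in_set[OF False] by (intro ball_cong) auto
    then show ?thesis
      using Cons.IH[OF False] False by (simp add: ball_Un) argo
  qed
qed simp

lemma induced_path_distinct: "induced_path b p \<Longrightarrow> distinct p"
  by (induction p) auto

lemma induced_path_rev:
  assumes "skew b" and "induced_path b p"
  shows "induced_path b (rev p)"
  using assms(2)
proof (induction p)
  case (Cons x p)
  show ?case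
  proof (cases "p = []")
    case False
    then have "\<forall>y\<in>set p. (b y x \<noteq> 0) = (y = hd p)"
      using Cons.prems skewD[OF assms(1), of x] by auto
    then show ?thesis
      using False Cons by (auto simp: induced_path_append last_rev)
  qed simp
qed simp

lemma induced_path_cong:
  assumes "\<And>u v. u \<in> set p \<Longrightarrow> v \<in> set p \<Longrightarrow> b u v = c u v"
  shows "induced_path b p = induced_path c p"
  using assms by (induction p) auto

text \<open>The first vertex is singled out only to reuse \<open>induced_path\<close> for the
  others. Closure under rotation and reversal shows that the choice does not matter.\<close>

fun chordless_cycle :: "('v \<Rightarrow> 'v \<Rightarrow> int) \<Rightarrow> 'v list \<Rightarrow> bool" where
  "chordless_cycle b [] \<longleftrightarrow> False"
| "chordless_cycle b (x # p) \<longleftrightarrow> 2 \<le> length p \<and> x \<notin> set p \<and> induced_path b p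
     \<and> (\<forall>y\<in>set p. b x y \<noteq> 0 \<longleftrightarrow> y = hd p \<or> y = last p)"

lemma chordless_cycle_distinct: "chordless_cycle b cs \<Longrightarrow> distinct cs"
  by (cases cs) (auto dest: induced_path_distinct)

lemma chordless_cycle_length: "chordless_cycle b cs \<Longrightarrow> 3 \<le> length cs"
  by (cases cs) auto

lemma chordless_cycle_cong:
  assumes "\<And>u v. u \<in> set cs \<Longrightarrow> v \<in> set cs \<Longrightarrow> b u v = c u v"
  shows "chordless_cycle b cs = chordless_cycle c cs"
proof (cases cs)
  case (Cons x p)
  then have "induced_path b p = induced_path c p"
    using assms by (intro induced_path_cong) auto
  then show ?thesis using assms Cons by auto
qed simp

lemma chordless_cycle_rotate1:
  assumes b: "skew b" and "chordless_cycle b cs"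
  shows "chordless_cycle b (rotate1 cs)"
proof -
  obtain x y z p where cs: "cs = x # y # z # p"
    using chordless_cycle_length[OF assms(2)]
    by (metis One_nat_def Suc_le_length_iff numeral_3_eq_3)
  have "last (z # p) \<in> set (z # p)" by simp
  then have "last (z # p) \<noteq> y" using assms(2) cs by auto
  moreover have "\<forall>u\<in>set (z # p). b u x \<noteq> 0 \<longleftrightarrow> u = last (z # p)"
    using assms(2) cs skewD[OF b, of x] by auto
  ultimately show ?thesis
    using assms(2) cs skewD[OF b, of x y] induced_path_append[of "z # p" "[x]" b] by auto
qed

lemma chordless_cycle_rotate:
  "skew b \<Longrightarrow> chordless_cycle b cs \<Longrightarrow> chordless_cycle b (rotate n cs)"
  by (induction n) (auto intro: chordless_cycle_rotate1)

lemma chordless_cycle_append_commute: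
  "skew b \<Longrightarrow> chordless_cycle b (p @ q) \<Longrightarrow> chordless_cycle b (q @ p)"
  using chordless_cycle_rotate[of b "p @ q" "length p"] by (simp add: rotate_append)

lemma chordless_cycle_rev:
  assumes "skew b" and "chordless_cycle b cs"
  shows "chordless_cycle b (rev cs)"
proof -
  obtain x p where cs: "cs = x # p" using assms(2) by (cases cs) auto
  have "p \<noteq> []" using assms(2) cs by auto
  then have "chordless_cycle b (x # rev p)"
    using assms cs by (auto intro: induced_path_rev simp: hd_rev last_rev)
  then show ?thesis
    using chordless_cycle_rotate1[OF assms(1)] cs by fastforce
qed

section \<open>Orientation and winding of cycles\<close>

definition cyclically_oriented :: "('v \<Rightarrow> 'v \<Rightarrow> int) \<Rightarrow> 'v list \<Rightarrow> bool" where
  "cyclically_oriented b cs \<longleftrightarrow> successively (\<lambda>u v. b u v > 0) (cs @ [hd cs])"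

lemma cyclically_oriented_rotate1: "cyclically_oriented b (rotate1 cs) \<longleftrightarrow> cyclically_oriented b cs"
proof (cases cs)
  case (Cons x c)
  then show ?thesis
    by (cases c) (auto simp: cyclically_oriented_def successively_append_iff successively_Cons hd_append)
qed simp

text \<open>The list \<open>q @ p\<close> below is an arbitrary rotation of \<open>cs\<close>.\<close>

definition wound_once :: "('v \<Rightarrow> 'v \<Rightarrow> int) \<Rightarrow> 'v list \<Rightarrow> 'v list \<Rightarrow> bool" where
  "wound_once b \<sigma> cs \<longleftrightarrow> cyclically_oriented b cs
     \<and> (\<exists>p q. cs = p @ q \<and> sorted_wrt (precedes \<sigma>) (q @ p))"

lemma wound_once_rotate1: "wound_once b \<sigma> (rotate1 cs) \<longleftrightarrow> wound_once b \<sigma> cs"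
proof (cases cs)
  case (Cons x c)
  have "(\<exists>p q. c @ [x] = p @ q \<and> sorted_wrt R (q @ p))
    \<longleftrightarrow> (\<exists>p q. x # c = p @ q \<and> sorted_wrt R (q @ p))" (is "?l \<longleftrightarrow> ?r") for R
  proof
    assume ?l
    then obtain p q where pq: "c @ [x] = p @ q" "sorted_wrt R (q @ p)" by blast
    show ?r
    proof (cases q rule: rev_cases)
      case Nil
      then show ?thesis using pq by (intro exI[of _ "[x]"] exI[of _ c]) simp
    next
      case (snoc q' y)
      then show ?thesis using pq by (intro exI[of _ "x # p"] exI[of _ q']) simp
    qed
  next
    assume ?r
    then obtain p q where pq: "x # c = p @ q" "sorted_wrt R (q @ p)" by blast
    show ?l
    proof (cases p)
      case Nil
      then show ?thesis using pq by (intro exI[of _ c] exI[of _ "[x]"]) auto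
    next
      case (Cons y p')
      then show ?thesis using pq by (intro exI[of _ p'] exI[of _ "q @ [x]"]) auto
    qed
  qed
  then show ?thesis
    using Cons by (simp add: wound_once_def cyclically_oriented_rotate1[of b "x # c", simplified])
qed simp

lemma wound_once_rev_rotate1: "wound_once b \<sigma> (rev (rotate1 cs)) \<longleftrightarrow> wound_once b \<sigma> (rev cs)"
  using wound_once_rotate1[of b \<sigma> "hd cs # rev (tl cs)"] by (cases cs) auto

text \<open>If the vertex moved to the end of \<sigma> lies on the cycle, it heads the increasing
  rotation, as nothing precedes it. Moving it to the end of that rotation as well restores the
  order.\<close>

lemma wound_once_cut1:
  assumes d: "distinct \<sigma>" and "wound_once b \<sigma> cs"
  shows "wound_once b (rotate1 \<sigma>) cs"
proof (cases \<sigma>)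
  case (Cons a \<tau>)
  obtain p q where pq: "cs = p @ q" "sorted_wrt (precedes \<sigma>) (q @ p)"
    and o: "cyclically_oriented b cs"
    using assms(2) unfolding wound_once_def by blast
  have da: "a \<notin> set \<tau>" using d Cons by simp
  have mono: "sorted_wrt (precedes (\<tau> @ [a])) ds"
    if "sorted_wrt (precedes \<sigma>) ds" "a \<notin> set ds" for ds
    by (rule sorted_wrt_mono_rel[OF _ that(1)]) (use that(2) Cons in \<open>auto simp: precedes_append\<close>)
  show ?thesis
  proof (cases "a \<in> set (q @ p)")
    case False
    then show ?thesis using mono[OF pq(2)] pq o Cons unfolding wound_once_def by auto
  next
    case True
    then obtain ds where ds: "q @ p = a # ds"
    proof (cases "q @ p")
      case (Cons d ds)
      moreover have "\<not> precedes \<sigma> d a" for d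
        using da \<open>\<sigma> = a # \<tau>\<close> by (auto dest: precedes_in)
      ultimately show ?thesis using True pq(2) that by auto
    qed simp
    then have "\<forall>d\<in>set ds. precedes \<sigma> a d" using pq(2) by simp
    then have dst: "set ds \<subseteq> set \<tau>" using da Cons by (auto dest: precedes_in)
    have "sorted_wrt (precedes (\<tau> @ [a])) ds"
      using mono pq(2) ds da dst by auto
    then have "sorted_wrt (precedes (rotate1 \<sigma>)) (ds @ [a])"
      using dst Cons by (auto simp: sorted_wrt_append precedes_append)
    then have s: "sorted_wrt (precedes (rotate1 \<sigma>)) (rotate1 (q @ p))" using ds by simp
    show ?thesis
    proof (cases q)
      case Nil
      then have "cs = [a] @ ds" using ds pq by simp
      then show ?thesis using s ds o unfolding wound_once_def by (metis rotate1.simps(2))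
    next
      case (Cons c q')
      then have "rotate1 (q @ p) = q' @ (p @ [c])" "cs = (p @ [c]) @ q'"
        using pq by auto
      then show ?thesis using s o unfolding wound_once_def by metis
    qed
  qed
qed (use assms in simp)

text \<open>A list also picks a direction of traversal, which need not agree with the arrows; hence
  the reversed list.\<close>

definition cyclically_good :: "('v \<Rightarrow> 'v \<Rightarrow> int) \<Rightarrow> 'v list \<Rightarrow> bool" where
  "cyclically_good b \<sigma> \<longleftrightarrow> (\<forall>cs. chordless_cycle b cs \<longrightarrow> set cs \<subseteq> set \<sigma> \<longrightarrow>
     wound_once b \<sigma> cs \<or> wound_once b \<sigma> (rev cs))"

lemma cyclically_good_rotate:
  assumes "distinct \<sigma>" and "cyclically_good b \<sigma>"
  shows "cyclically_good b (rotate n \<sigma>)"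
  using assms(2)
proof (induction n)
  case (Suc n)
  then show ?case
    using assms(1) wound_once_cut1[of "rotate n \<sigma>" b] unfolding cyclically_good_def by auto
qed simp

lemma wound_once_or_rev_rotate:
  "wound_once b \<sigma> (rotate n cs) \<or> wound_once b \<sigma> (rev (rotate n cs))
     \<longleftrightarrow> wound_once b \<sigma> cs \<or> wound_once b \<sigma> (rev cs)"
  by (induction n) (auto simp: wound_once_rotate1 wound_once_rev_rotate1)

text \<open>A genuine rotation would put the last vertex of the list before its first one, against
  the third hypothesis. So the list itself is the increasing rotation.\<close>

lemma wound_once_sorted:
  assumes "distinct \<sigma>" and "wound_once b \<sigma> (u # p)" and "precedes \<sigma> u (last (u # p))"
  shows "sorted_wrt (precedes \<sigma>) (u # p)"
proof -
  obtain r q where rq: "u # p = r @ q" "sorted_wrt (precedes \<sigma>) (q @ r)"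
    using assms(2) unfolding wound_once_def by blast
  show ?thesis
  proof (cases "r = [] \<or> q = []")
    case False
    then have "u \<in> set r" "last (u # p) \<in> set q"
      using rq(1) by (metis hd_in_set hd_append2 list.sel(1), metis last_appendR last_in_set)
    then have "precedes \<sigma> (last (u # p)) u" using rq(2) by (auto simp: sorted_wrt_append)
    then show ?thesis using assms(1,3) precedes_asym by metis
  qed (use rq in auto)
qed

lemma cyclically_oriented_Cons:
  "p \<noteq> [] \<Longrightarrow> cyclically_oriented b (x # p)
    \<longleftrightarrow> b x (hd p) > 0 \<and> successively (\<lambda>u v. b u v > 0) p \<and> b (last p) x > 0"
  by (auto simp: cyclically_oriented_def successively_Cons successively_append_iff)

lemma wound_once_rev_Cons: "wound_once b \<sigma> (rev (x # p)) \<longleftrightarrow> wound_once b \<sigma> (x # rev p)"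
  using wound_once_rotate1[of b \<sigma> "x # rev p"] by simp

lemma cyclically_good_cases:
  assumes "cyclically_good b \<sigma>" and "chordless_cycle b (x # p)" and "set (x # p) \<subseteq> set \<sigma>"
  obtains "wound_once b \<sigma> (x # p)" "b x (hd p) > 0" "b (last p) x > 0"
  | "wound_once b \<sigma> (x # rev p)" "b (hd p) x > 0" "b x (last p) > 0"
proof -
  have p: "p \<noteq> []" using assms(2) by auto
  have "wound_once b \<sigma> (x # p) \<or> wound_once b \<sigma> (x # rev p)"
    using assms wound_once_rev_Cons unfolding cyclically_good_def by metis
  then show ?thesis
    using that p cyclically_oriented_Cons[of p b x] cyclically_oriented_Cons[of "rev p" b x]
    unfolding wound_once_def by (auto simp: hd_rev last_rev)
qed

text \<open>The closing edge of the cycle ends in \<open>last q\<close>, which lies outside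
  \<open>p\<close>.\<close>

lemma chordless_cycle_prefix:
  assumes "chordless_cycle b (p @ q)" and "q \<noteq> []"
  shows "induced_path b p"
proof (cases p)
  case (Cons x p')
  show ?thesis
  proof (cases "p' = []")
    case False
    have ip: "induced_path b p'" "set p' \<inter> set q = {}"
      and x: "x \<notin> set p'" "\<forall>y\<in>set p'. (b x y \<noteq> 0) = (y = hd p' \<or> y = last q)"
      using assms Cons False induced_path_append[of p' q b] by auto
    moreover have "last q \<notin> set p'" using ip(2) assms(2) by (meson disjoint_iff last_in_set)
    ultimately show ?thesis using Cons by auto
  qed (use Cons in simp)
qed simp

lemma successively_conj:
  "successively (\<lambda>x y. P x y \<and> R x y) xs \<longleftrightarrow> successively P xs \<and> successively R xs"
  by (induction xs) (auto simp: successively_Cons)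

section \<open>Proper mutations preserve the cycle condition\<close>

text \<open>The circle is cut at \<open>j\<close> once wiggles have separated its out-neighbours
  from its in-neighbours. Vertices not adjacent to \<open>j\<close> may lie in either list.\<close>

locale proper_cut =
  fixes b :: "'v \<Rightarrow> 'v \<Rightarrow> int" and j :: 'v and xs ys :: "'v list"
  assumes skew: "skew b"
    and dist: "distinct (j # xs @ ys)"
    and out_xs: "v \<in> set xs \<Longrightarrow> b j v \<ge> 0"
    and in_ys: "v \<in> set ys \<Longrightarrow> b j v \<le> 0"
    and pos: "positive b (j # xs @ ys)"
    and good: "cyclically_good b (j # xs @ ys)"
begin

abbreviation b' where "b' \<equiv> mu j b"

text \<open>Cut before \<open>j\<close>, the mutated order \<open>xs @ j # ys\<close> reads \<open>j # M\<close>; the original order, cut at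
  the same place between \<open>xs\<close> and \<open>ys\<close>, reads \<open>ys @ j # xs\<close>. So all vertices other than \<open>j\<close> are
  compared by \<open>M\<close> in both.\<close>

abbreviation M where "M \<equiv> ys @ xs"

lemma pos': "positive b' (xs @ j # ys)"
  using positive_mu[OF skew dist out_xs in_ys pos] .

lemma skew': "skew b'"
  using skew_mu[OF skew] .

lemma b_le_1: "u \<in> set (j # M) \<Longrightarrow> v \<in> set (j # M) \<Longrightarrow> \<bar>b u v\<bar> \<le> 1"
  by (rule positive_le_1[OF skew dist pos]) auto

lemma b'_le_1: "u \<in> set (j # M) \<Longrightarrow> v \<in> set (j # M) \<Longrightarrow> \<bar>b' u v\<bar> \<le> 1"
  using dist by (intro positive_le_1[OF skew' _ pos']) auto

lemma good_old: "cyclically_good b (ys @ j # xs)"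
  using cyclically_good_rotate[OF dist good, of "length (j # xs)"] rotate_append[of "j # xs" ys]
  by (metis append_Cons)

section \<open>Entries of the mutated matrix\<close>

lemma nbr_cases:
  assumes "v \<in> set M" and "b j v \<noteq> 0"
  obtains "b j v = 1" "v \<in> set xs" | "b j v = -1" "v \<in> set ys"
  using assms b_le_1[of j v] out_xs[of v] in_ys[of v] by force

lemma b'_same:
  assumes "u \<noteq> j" "v \<noteq> j" and "b j u * b j v \<ge> 0"
  shows "b' u v = b u v"
proof -
  have "max 0 (b u j) * max 0 (b j v) = 0" "max 0 (b v j) * max 0 (b j u) = 0"
    using assms(3) skewD[OF skew, of u j] skewD[OF skew, of v j] by (auto simp: max_def zero_le_mult_iff)
  moreover have "b' u v = b u v + max 0 (b u j) * max 0 (b j v) - max 0 (b v j) * max 0 (b j u)"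
    using assms(1,2) by (simp add: mu_def)
  ultimately show ?thesis by linarith
qed

lemma b'_opp:
  assumes "b j i = -1" and "b j k = 1"
  shows "b' i k = b i k + 1"
proof -
  have "i \<noteq> j" "k \<noteq> j" using assms skew_diag[OF skew, of j] by auto
  then show ?thesis
    using assms skewD[OF skew, of i j] skewD[OF skew, of k j] by (simp add: mu_def)
qed

lemma b'_j: "b' j v = - b j v" "b' v j = b j v"
  using skewD[OF skew, of v j] by (auto simp: mu_def)

text \<open>The path through \<open>j\<close> contributes one arrow from \<open>i\<close> to
  \<open>k\<close>. Neither form allows a double arrow, so it either cancels an arrow from
  \<open>k\<close> to \<open>i\<close> or joins two vertices that were not adjacent.\<close>

lemma opp_values:
  assumes "i \<in> set M" "k \<in> set M" and "b j i = -1" and "b j k = 1"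
  shows "b' i k = 0 \<and> b i k = -1 \<or> b' i k = 1 \<and> b i k = 0"
  using b'_opp[OF assms(3,4)] b_le_1[of i k] b'_le_1[of i k] assms by auto

lemma precedes_opp:
  assumes "i \<in> set M" "k \<in> set M" and "b j i = -1" and "b j k = 1"
  shows "precedes M i k" and "precedes (ys @ j # xs) i k"
  using assms out_xs[of i] in_ys[of k] by (auto simp: precedes_append)

lemma sorted_old_new:
  assumes "sorted_wrt (precedes (ys @ j # xs)) p" and "j \<notin> set p"
  shows "sorted_wrt (precedes M) p"
  by (rule sorted_wrt_mono_rel[OF _ assms(1)]) (use assms(2) in \<open>auto simp: precedes_append\<close>)

lemma sorted_M: "sorted_wrt (precedes M) p \<Longrightarrow> sorted_wrt (precedes (j # M)) p"
  by (erule sorted_wrt_mono_rel[rotated]) simp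

lemma not_j: "v \<in> set M \<Longrightarrow> v \<noteq> j"
  using dist by auto

section \<open>Arcs between neighbours of the mutated vertex\<close>

lemma successively_mu:
  assumes "A \<noteq> []" and "set (u # A @ [w]) \<subseteq> set M" and "\<forall>v\<in>set A. b j v = 0"
  shows "successively (\<lambda>u v. b' u v > 0) (u # A @ [w]) \<longleftrightarrow> successively (\<lambda>u v. b u v > 0) (u # A @ [w])"
proof -
  have 1: "b' x y = b x y" "b' y x = b y x" if "x \<in> set A" "y \<in> set (u # A @ [w])" for x y
    using that assms not_j by (auto intro!: b'_same)
  then have "successively (\<lambda>u v. b' u v > 0) A = successively (\<lambda>u v. b u v > 0) A"
    by (intro successively_cong) auto
  then show ?thesis
    using 1[of "hd A" u] 1[of "last A" w] assms(1)
    by (simp add: successively_Cons successively_append_iff)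
qed

text \<open>Mutation reverses the arrows at \<open>j\<close>, so afterwards \<open>j\<close> points
  to \<open>hd p\<close> and \<open>last p\<close> points to \<open>j\<close>. Such a path is what
  remains of an oriented, once wound cycle when \<open>j\<close> is removed.\<close>

definition fwd :: "'v list \<Rightarrow> bool" where
  "fwd p \<longleftrightarrow> b j (hd p) = -1 \<and> b j (last p) = 1 \<and> sorted_wrt (precedes M) p
     \<and> successively (\<lambda>u v. b' u v > 0) p"

text \<open>Closing the path through \<open>j\<close> gives a chordless cycle already before the mutation, which
  could not be oriented if the ends were of the same type.\<close>

lemma arc_ends_differ:
  assumes ip: "induced_path b' (u # A @ [w])" and sub: "set (u # A @ [w]) \<subseteq> set M"
    and nbrs: "b j u \<noteq> 0" "b j w \<noteq> 0" "\<forall>v\<in>set A. b j v = 0"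
  shows "b j u \<noteq> b j w"
proof
  assume eq: "b j u = b j w"
  let ?p = "u # A @ [w]"
  have "induced_path b' ?p = induced_path b ?p"
    using sub nbrs eq not_j by (intro induced_path_cong b'_same) auto
  moreover have "j \<notin> set ?p" using sub not_j by blast
  moreover have "\<forall>y\<in>set ?p. b j y \<noteq> 0 \<longleftrightarrow> y = hd ?p \<or> y = last ?p"
    using nbrs by auto
  ultimately have "chordless_cycle b (j # ?p)"
    using ip by simp
  then show False
  proof (rule cyclically_good_cases[OF good])
    show "set (j # ?p) \<subseteq> set (j # xs @ ys)" using sub by auto
  next
    assume "b j (hd ?p) > 0" "b (last ?p) j > 0"
    then show False using eq skewD[OF skew, of w j] by simp
  next
    assume "b (hd ?p) j > 0" "b j (last ?p) > 0"
    then show False using eq skewD[OF skew, of u j] by simp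
  qed
qed

text \<open>If \<open>A\<close> is empty, the edge is the arrow from \<open>u\<close> to
  \<open>w\<close> created by the mutation. Otherwise \<open>u\<close> and \<open>w\<close> are not
  adjacent afterwards, so an arrow from \<open>w\<close> to \<open>u\<close> was cancelled, and it
  used to close the path to a chordless cycle. That cycle was wound once, and since \<open>u\<close>
  comes before \<open>w\<close> in the cut, its increasing rotation starts at
  \<open>u\<close>.\<close>

lemma arc_in_out:
  assumes ip: "induced_path b' (u # A @ [w])" and sub: "set (u # A @ [w]) \<subseteq> set M"
    and nbrs: "b j u = -1" "b j w = 1" "\<forall>v\<in>set A. b j v = 0"
  shows "fwd (u # A @ [w])"
proof (cases "A = []")
  case True
  then show ?thesis
    using opp_values[of u w] precedes_opp[of u w] assms by (auto simp: fwd_def)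
next
  case False
  let ?p = "u # A @ [w]"
  have dp: "distinct ?p" using induced_path_distinct[OF ip] .
  have jp: "j \<notin> set ?p" using sub not_j by blast
  have "hd A \<noteq> w" using dp False by (metis distinct.simps(2) distinct_append hd_in_set
      disjoint_iff list.set_intros(1))
  then have "b' u w = 0" using ip False by auto
  then have buw: "b u w = -1" using opp_values[of u w] sub nbrs by auto
  have same: "b' x y = b x y" if "x \<in> set ?p" "y \<in> set A" for x y
    using that sub nbrs not_j by (auto intro!: b'_same)
  have "induced_path b' (A @ [w]) = induced_path b (A @ [w])"
    using sub nbrs not_j by (intro induced_path_cong b'_same) auto
  moreover have "\<forall>y\<in>set (A @ [w]). b u y \<noteq> 0 \<longleftrightarrow> y = hd (A @ [w]) \<or> y = last (A @ [w])"
    using ip False same[of u] buw \<open>hd A \<noteq> w\<close> dp by auto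
  ultimately have cyc: "chordless_cycle b ?p"
    using ip False by (cases A) auto
  have w: "wound_once b (ys @ j # xs) ?p"
  proof (rule cyclically_good_cases[OF good_old cyc])
    show "set ?p \<subseteq> set (ys @ j # xs)" using sub by auto
  next
    assume "b u (last (A @ [w])) > 0"
    then show ?thesis using buw by simp
  qed
  have "sorted_wrt (precedes (ys @ j # xs)) ?p"
    using precedes_opp(2)[of u w] sub nbrs dist by (intro wound_once_sorted[OF _ w]) auto
  then have "sorted_wrt (precedes M) ?p"
    using sorted_old_new jp by blast
  moreover have "successively (\<lambda>u v. b u v > 0) ?p"
    using w False cyclically_oriented_Cons[of "A @ [w]" b u]
    unfolding wound_once_def by (auto simp: successively_Cons)
  ultimately show ?thesis
    using successively_mu[OF False sub nbrs(3)] nbrs by (simp add: fwd_def)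
qed

lemma arc:
  assumes ip: "induced_path b' (u # A @ [w])" and sub: "set (u # A @ [w]) \<subseteq> set M"
    and nbrs: "b j u \<noteq> 0" "b j w \<noteq> 0" "\<forall>v\<in>set A. b j v = 0"
  shows "fwd (u # A @ [w]) \<or> fwd (rev (u # A @ [w]))"
proof -
  have "b j u = -1 \<and> b j w = 1 \<or> b j u = 1 \<and> b j w = -1"
    using arc_ends_differ[OF assms] nbrs sub nbr_cases[of u] nbr_cases[of w]
    by (metis append_is_Nil_conv in_mono last.simps last_in_set last_snoc list.set_intros(1) neq_Nil_conv)
  then show ?thesis
    using arc_in_out[OF ip sub] arc_in_out[of w "rev A" u] induced_path_rev[OF skew' ip] sub nbrs
    by auto
qed

text \<open>The closing arrow from \<open>w\<close> to \<open>u\<close> is created by the path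
  through \<open>j\<close>. Before the mutation the detour through \<open>j\<close> took its place,
  so \<open>j # u # A @ [w]\<close> was a chordless cycle. Deleting \<open>j\<close> from it
  preserves the winding of the rest.\<close>

lemma closing_arc:
  assumes cyc: "chordless_cycle b' (u # A @ [w])" and sub: "set (u # A @ [w]) \<subseteq> set M"
    and nbrs: "b j u = 1" "b j w = -1" "\<forall>v\<in>set A. b j v = 0"
  shows "wound_once b' (j # M) (u # A @ [w])"
proof -
  let ?p = "u # A @ [w]"
  have A: "A \<noteq> []" using cyc by auto
  have jp: "j \<notin> set ?p" using sub not_j by blast
  have dp: "distinct ?p" using chordless_cycle_distinct[OF cyc] .
  have "b' u w \<noteq> 0" using cyc by auto
  then have wu: "b' w u = 1" "b w u = 0"
    using opp_values[of w u] sub nbrs skewD[OF skew', of u w] by auto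
  have uw: "b u w = 0" using wu skewD[OF skew, of u w] by simp
  have same: "b' x y = b x y" if "x \<in> set ?p" "y \<in> set A" for x y
    using that sub nbrs not_j by (auto intro!: b'_same)
  have "induced_path b' (A @ [w]) = induced_path b (A @ [w])"
    using sub nbrs not_j by (intro induced_path_cong b'_same) auto
  moreover have "\<forall>y\<in>set (A @ [w]). b u y \<noteq> 0 \<longleftrightarrow> y = hd (A @ [w])"
  proof
    fix y assume y: "y \<in> set (A @ [w])"
    show "b u y \<noteq> 0 \<longleftrightarrow> y = hd (A @ [w])"
    proof (cases "y \<in> set A")
      case True
      then have "y \<noteq> w" using dp by auto
      moreover have "b' u y = b u y" using same[of u y] True by simp
      moreover have "b' u y \<noteq> 0 \<longleftrightarrow> y = hd (A @ [w]) \<or> y = w" using cyc True by simp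
      ultimately show ?thesis by simp
    next
      case False
      then have "y = w" "hd A \<noteq> w" using y A by auto
      then show ?thesis using uw A by auto
    qed
  qed
  ultimately have "induced_path b ?p"
    using cyc by simp
  moreover have "\<forall>y\<in>set ?p. b j y \<noteq> 0 \<longleftrightarrow> y = hd ?p \<or> y = last ?p"
    using nbrs by auto
  ultimately have cyc2: "chordless_cycle b (j # ?p)"
    using jp by simp
  have wj: "wound_once b (ys @ j # xs) (j # ?p)"
  proof (rule cyclically_good_cases[OF good_old cyc2])
    show "set (j # ?p) \<subseteq> set (ys @ j # xs)" using sub by auto
  next
    assume "b (hd ?p) j > 0"
    then show ?thesis using nbrs skewD[OF skew, of u j] by simp
  qed
  then obtain p q where pq: "j # ?p = p @ q" "sorted_wrt (precedes (ys @ j # xs)) (q @ p)"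
    unfolding wound_once_def by blast
  \<comment> \<open>Deleting \<open>j\<close> from both parts of the rotation keeps it
    increasing.\<close>
  let ?f = "filter (\<lambda>v. v \<noteq> j)"
  have "?f ?p = ?p" using jp by (intro filter_True) auto
  then have "?f (j # ?p) = ?p" by (simp only: filter.simps) simp
  then have "?p = ?f p @ ?f q" unfolding pq(1) by simp
  moreover have "sorted_wrt (precedes (j # M)) (?f q @ ?f p)"
    using sorted_wrt_filter[OF pq(2), of "\<lambda>v. v \<noteq> j"]
    by (intro sorted_M sorted_old_new) auto
  moreover have "successively (\<lambda>u v. b u v > 0) ?p"
    using wj cyclically_oriented_Cons[of ?p b j] unfolding wound_once_def by auto
  then have "successively (\<lambda>u v. b' u v > 0) ?p"
    using successively_mu[OF A sub nbrs(3)] by blast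
  then have "cyclically_oriented b' ?p"
    using cyclically_oriented_Cons[of "A @ [w]" b' u] wu by (simp add: successively_Cons)
  ultimately show ?thesis
    unfolding wound_once_def by blast
qed

section \<open>Cycles all of whose arrows are increasing\<close>

definition increasing_edge :: "'v \<Rightarrow> 'v \<Rightarrow> bool" where
  "increasing_edge u v \<longleftrightarrow> b' u v > 0 \<and> precedes M u v \<or> b' v u > 0 \<and> precedes M v u"

lemma fwd_increasing: "fwd p \<Longrightarrow> successively increasing_edge p"
proof -
  assume "fwd p"
  then have "successively (\<lambda>u v. b' u v > 0 \<and> precedes M u v) p"
    unfolding fwd_def successively_conj using successively_if_sorted_wrt by blast
  then show ?thesis by (rule successively_mono) (auto simp: increasing_edge_def)
qed

lemma increasing_edge_sym: "increasing_edge u v = increasing_edge v u"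
  by (auto simp: increasing_edge_def)

text \<open>On a cycle all of whose arrows are increasing, the all-ones vector is isotropic.\<close>

lemma no_increasing_cycle:
  assumes cyc: "chordless_cycle b' cs" and sub: "set cs \<subseteq> set M"
    and inc: "\<And>n x y D. rotate n cs = x # y # D \<Longrightarrow> increasing_edge x y"
  shows False
proof -
  define one where "one = (\<lambda>v. if v \<in> set cs then 1 else (0 :: int))"
  have dM: "distinct (j # M)" using dist by auto
  have gram_edge: "gram b' (j # M) x y = -1"
    if "increasing_edge x y" "x \<in> set cs" "y \<in> set cs" for x y
  proof -
    have xy: "x \<in> set M" "y \<in> set M" "x \<noteq> j" "y \<noteq> j" using that sub not_j by auto
    then have "\<bar>b' x y\<bar> \<le> 1" using b'_le_1 by simp
    moreover have "b' y x = - b' x y" using skewD[OF skew'] .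
    moreover have "x \<noteq> y"
      using that skew_diag[OF skew', of x] by (auto simp: increasing_edge_def)
    moreover have "precedes M y x \<Longrightarrow> \<not> precedes M x y"
      using precedes_asym[of M y x] dM by auto
    ultimately show ?thesis
      using that(1) xy unfolding increasing_edge_def gram_def by auto
  qed
  \<comment> \<open>Within the cycle a row has the diagonal entry 2 and an entry -1 for each of the
    two neighbours \<open>h\<close> and \<open>l\<close> of \<open>v\<close>.\<close>
  have row: "(\<Sum>w\<in>set cs. gram b' (j # M) v w) = 0" if v: "v \<in> set cs" for v
  proof -
    obtain c1 c2 where "cs = c1 @ v # c2" using v by (meson split_list)
    define p where "p = c2 @ c1"
    have r: "rotate (length c1) cs = v # p"
      using \<open>cs = c1 @ v # c2\<close> by (simp add: rotate_append p_def)
    have cp: "chordless_cycle b' (v # p)"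
      using chordless_cycle_rotate[OF skew' cyc] r by metis
    have scs: "set cs = insert v (set p)" using r by (metis list.simps(15) set_rotate)
    obtain h m l where p: "p = h # m @ [l]"
    proof -
      have "2 \<le> length p" using cp by simp
      then obtain h p' where "p = h # p'" "p' \<noteq> []"
        by (metis Suc_le_length_iff list.size(3) not_less_eq_eq numeral_2_eq_2 zero_le)
      then show ?thesis using that by (metis rev_exhaust)
    qed
    have "increasing_edge v h" using inc r p by simp
    \<comment> \<open>\<open>inc\<close> speaks of the first edge of a rotation, so the closing edge
      is reached by rotating until \<open>l\<close> comes first.\<close>
    moreover have "increasing_edge l v"
    proof -
      have "rotate (length (v # h # m) + length c1) cs = rotate (length (v # h # m)) (v # p)"
        using r by (metis rotate_rotate)
      also have "\<dots> = l # v # h # m"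
        using rotate_append[of "v # h # m" "[l]"] p by simp
      finally show ?thesis using inc by blast
    qed
    ultimately have g: "gram b' (j # M) v h = -1" "gram b' (j # M) v l = -1"
      using gram_edge[of v h] gram_edge[of v l] increasing_edge_sym scs p by auto
    have hl: "h \<noteq> l" "v \<notin> set p" using chordless_cycle_distinct[OF cp] p by auto
    have "gram b' (j # M) v w = 0" if "w \<in> set p - {h, l}" for w
      using that cp p hl by (auto simp: gram_def)
    then have "(\<Sum>w\<in>set p. gram b' (j # M) v w) = (\<Sum>w\<in>{h, l}. gram b' (j # M) v w)"
      using p by (intro sum.mono_neutral_right) auto
    then have "(\<Sum>w\<in>set p. gram b' (j # M) v w) = -2" using g hl by simp
    then show ?thesis
      using scs hl by (simp add: gram_def[of _ _ v v])
  qed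
  have "2 * tits b' (j # M) one = (\<Sum>u\<in>set cs. \<Sum>v\<in>set cs. gram b' (j # M) u v * one u * one v)"
    using sub by (intro tits_support[OF skew' dM]) (auto simp: one_def)
  also have "\<dots> = (\<Sum>u\<in>set cs. \<Sum>v\<in>set cs. gram b' (j # M) u v)"
    by (intro sum.cong) (auto simp: one_def)
  also have "\<dots> = 0" using row by simp
  finally have "tits b' (j # M) one = 0" by simp
  moreover have "positive b' (j # M)"
    using positive_rotate[OF skew' _ pos', of "length xs"] dist by (simp add: rotate_append)
  moreover have "\<exists>v\<in>set (j # M). one v \<noteq> 0"
  proof -
    have "cs \<noteq> []" using cyc by auto
    then have "hd cs \<in> set cs" by simp
    then show ?thesis using sub by (intro bexI[of _ "hd cs"]) (auto simp: one_def)
  qed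
  ultimately show False unfolding positive_def by (metis less_irrefl)
qed

section \<open>Cycles of the mutated quiver, by their position relative to \<open>j\<close>\<close>

lemma wound_through_j:
  assumes "fwd p" and "p \<noteq> []" and "set p \<subseteq> set M"
  shows "wound_once b' (j # M) (j # p)"
proof -
  have "sorted_wrt (precedes (j # M)) (j # p)"
    using assms sorted_M[of p] by (auto simp: fwd_def)
  moreover have "cyclically_oriented b' (j # p)"
    using assms b'_j cyclically_oriented_Cons[of p b' j] by (simp add: fwd_def)
  ultimately show ?thesis
    unfolding wound_once_def by (metis append_Nil append_Nil2)
qed

text \<open>The two vertices next to \<open>j\<close> are its only neighbours on the cycle, so the
  rest of the cycle is an arc.\<close>

lemma cycle_through_j:
  assumes cyc: "chordless_cycle b' (j # p)" and sub: "set p \<subseteq> set M"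
  shows "wound_once b' (j # M) (j # p) \<or> wound_once b' (j # M) (rev (j # p))"
proof -
  have "2 \<le> length p" using cyc by simp
  then obtain u p' where "p = u # p'" "p' \<noteq> []"
    by (metis Suc_le_length_iff list.size(3) not_less_eq_eq numeral_2_eq_2 zero_le)
  then obtain A w where p: "p = u # A @ [w]" by (metis rev_exhaust)
  have "distinct p" using chordless_cycle_distinct[OF cyc] by simp
  then have "\<forall>y\<in>set A. y \<noteq> u \<and> y \<noteq> w" using p by auto
  then have "b j u \<noteq> 0" "b j w \<noteq> 0" "\<forall>v\<in>set A. b j v = 0"
    using cyc p by (auto simp: b'_j)
  then have "fwd p \<or> fwd (rev p)"
    using arc[of u A w] cyc sub p by simp
  then show ?thesis
    using wound_through_j[of p] wound_through_j[of "rev p"] sub p wound_once_rev_Cons[of _ _ j p]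
    by auto
qed

text \<open>Away from \<open>j\<close>, mutation changes only entries between an in-neighbour and an
  out-neighbour of \<open>j\<close>. Hence the cycle was there before, with the same arrows and the
  same relative order.\<close>

lemma cycle_one_type:
  assumes cyc: "chordless_cycle b' cs" and sub: "set cs \<subseteq> set M"
    and t: "\<And>u v. u \<in> set cs \<Longrightarrow> v \<in> set cs \<Longrightarrow> b j u * b j v \<ge> 0"
  shows "wound_once b' (j # M) cs \<or> wound_once b' (j # M) (rev cs)"
proof -
  have same: "b' u v = b u v" if "u \<in> set cs" "v \<in> set cs" for u v
    using that sub t not_j by (intro b'_same) auto
  have "chordless_cycle b cs"
    using cyc chordless_cycle_cong[of cs b' b] same by blast
  then have "wound_once b (ys @ j # xs) cs \<or> wound_once b (ys @ j # xs) (rev cs)"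
    using good_old sub unfolding cyclically_good_def by auto
  moreover have "wound_once b' (j # M) ds" if "wound_once b (ys @ j # xs) ds" "set ds = set cs" for ds
  proof -
    obtain p q where pq: "ds = p @ q" "sorted_wrt (precedes (ys @ j # xs)) (q @ p)"
      using \<open>wound_once b _ ds\<close> unfolding wound_once_def by blast
    have "j \<notin> set (q @ p)" using pq that(2) sub not_j by auto
    then have "sorted_wrt (precedes (j # M)) (q @ p)"
      using sorted_M sorted_old_new pq(2) by blast
    moreover have "ds \<noteq> []" using that(2) cyc by auto
    then have "hd ds \<in> set cs" using that(2) hd_in_set by blast
    then have "cyclically_oriented b' ds = cyclically_oriented b ds"
      using same that(2) unfolding cyclically_oriented_def by (intro successively_cong) auto
    ultimately show ?thesis using that(1) pq(1) unfolding wound_once_def by auto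
  qed
  ultimately show ?thesis by auto
qed

text \<open>If \<open>j\<close> has just two neighbours on the cycle and they are consecutive there,
  \<open>closing_arc\<close> applies. Otherwise each edge lies on an arc between successive
  neighbours of \<open>j\<close> that is a proper piece of the cycle, hence an induced path; by
  \<open>arc\<close> its arrows are increasing. That makes all edges increasing, which
  \<open>no_increasing_cycle\<close> forbids.\<close>

lemma cycle_two_types:
  assumes cyc: "chordless_cycle b' cs" and sub: "set cs \<subseteq> set M"
    and i: "i \<in> set cs" "b j i = -1" and k: "k \<in> set cs" "b j k = 1"
  shows "wound_once b' (j # M) cs \<or> wound_once b' (j # M) (rev cs)"
proof (cases "\<exists>n u A w. rotate n cs = u # A @ [w] \<and> b j u \<noteq> 0 \<and> b j w \<noteq> 0 \<and> (\<forall>v\<in>set A. b j v = 0)")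
  case True
  then obtain n u A w where r: "rotate n cs = u # A @ [w]"
    and nz: "b j u \<noteq> 0" "b j w \<noteq> 0" and A: "\<forall>v\<in>set A. b j v = 0"
    by blast
  have s: "set cs = set (u # A @ [w])" using r by (metis set_rotate)
  have c: "chordless_cycle b' (u # A @ [w])"
    using chordless_cycle_rotate[OF skew' cyc] r by metis
  have "i \<in> {u, w}" "k \<in> {u, w}" using i k A s by auto
  then have "b j u = 1 \<and> b j w = -1 \<or> b j u = -1 \<and> b j w = 1"
    using i k by auto
  then have "wound_once b' (j # M) (rotate n cs) \<or> wound_once b' (j # M) (rev (rotate n cs))"
    using closing_arc[OF c] closing_arc[of w "rev A" u] chordless_cycle_rev[OF skew' c] A s sub r
    by auto
  then show ?thesis using wound_once_or_rev_rotate by blast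
next
  case False
  have "increasing_edge x y" if r: "rotate n cs = x # y # D" for n x y D
  proof -
    \<comment> \<open>Read from \<open>y\<close> round to \<open>x\<close>, the given edge becomes
      the closing one. The arc containing it runs from the last neighbour \<open>u\<close> of
      \<open>j\<close> in \<open>E\<close>, across this edge, to the first neighbour
      \<open>w\<close>.\<close>
    define E where "E = y # D @ [x]"
    have E: "E = rotate (Suc n) cs" using r by (simp add: E_def)
    have sE: "set E = set cs" using E by (metis set_rotate)
    have "\<exists>v\<in>set E. b j v \<noteq> 0" using i sE by (metis zero_neq_neg_one)
    then obtain A1 w R where E1: "E = A1 @ w # R" and w: "b j w \<noteq> 0" and A1: "\<forall>v\<in>set A1. b j v = 0"
      using split_list_first_prop[of E "\<lambda>v. b j v \<noteq> 0"] by blast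
    have "\<exists>v\<in>set (w # R). b j v \<noteq> 0" using w by simp
    then obtain R' u R2 where E2: "w # R = R' @ u # R2" and u: "b j u \<noteq> 0" and R2: "\<forall>v\<in>set R2. b j v = 0"
      using split_list_last_prop[of "w # R" "\<lambda>v. b j v \<noteq> 0"] by blast
    \<comment> \<open>\<open>u = w\<close> would leave a single neighbour of \<open>j\<close> on the
      cycle, but \<open>i\<close> and \<open>k\<close> are two.\<close>
    have "R' \<noteq> []"
    proof
      assume "R' = []"
      then have "\<forall>v\<in>set E. v \<noteq> w \<longrightarrow> b j v = 0" using E1 E2 A1 R2 by auto
      then have "i = w" "k = w" using i k sE by (metis zero_neq_neg_one, metis zero_neq_one)
      then show False using i k by simp
    qed
    then obtain R1 where R1: "R' = w # R1" using E2 by (cases R') auto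
    let ?P = "u # (R2 @ A1) @ [w]"
    have EP: "rotate (length (A1 @ w # R1)) E = ?P @ R1"
      using rotate_append[of "A1 @ w # R1" "u # R2"] E1 E2 R1 by simp
    then have rP: "rotate (length (A1 @ w # R1) + Suc n) cs = ?P @ R1"
      using E by (metis rotate_rotate)
    \<comment> \<open>With nothing left over, this rotation would fall under the case already
      treated.\<close>
    have "R1 \<noteq> []"
    proof
      assume "R1 = []"
      then have "rotate (length (A1 @ w # R1) + Suc n) cs = u # (R2 @ A1) @ [w]" using rP by simp
      moreover have "\<forall>v\<in>set (R2 @ A1). b j v = 0" using A1 R2 by auto
      ultimately show False using False u w by blast
    qed
    moreover have "chordless_cycle b' (?P @ R1)"
      using chordless_cycle_rotate[OF skew' cyc] rP by metis
    ultimately have "induced_path b' ?P" using chordless_cycle_prefix by blast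
    moreover have "set ?P \<subseteq> set M"
      using rP sub by (metis set_rotate set_append sup.boundedE)
    ultimately have "fwd ?P \<or> fwd (rev ?P)"
      using arc u w A1 R2 by (metis Un_iff set_append)
    then have "successively increasing_edge ?P"
      using fwd_increasing[of ?P] fwd_increasing[of "rev ?P"] increasing_edge_sym
      unfolding successively_rev by (metis (mono_tags, lifting) successively_mono)
    then have "successively increasing_edge ((u # R2) @ (A1 @ [w]))" by simp
    then have "increasing_edge (last (u # R2)) (hd (A1 @ [w]))"
      unfolding successively_append_iff by blast
    moreover have "last E = last (u # R2)" using E1 E2 by (metis last_appendR list.discI)
    moreover have "hd E = hd (A1 @ [w])" using E1 by (cases A1) auto
    ultimately show ?thesis by (simp add: E_def)
  qed
  then show ?thesis using no_increasing_cycle[OF cyc sub] by blast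
qed

lemma cyclically_good_mu: "cyclically_good b' (xs @ j # ys)"
proof -
  have "wound_once b' (j # M) cs \<or> wound_once b' (j # M) (rev cs)"
    if cyc: "chordless_cycle b' cs" and sub: "set cs \<subseteq> set (j # M)" for cs
  proof (cases "j \<in> set cs")
    case True
    then obtain c1 c2 where cs: "cs = c1 @ j # c2" by (meson split_list)
    then have r: "rotate (length c1) cs = j # c2 @ c1" by (simp add: rotate_append)
    then have c: "chordless_cycle b' (j # c2 @ c1)"
      using chordless_cycle_rotate[OF skew' cyc] by metis
    have "set (c2 @ c1) \<subseteq> set M"
      using chordless_cycle_distinct[OF c] sub cs by auto
    then show ?thesis
      using cycle_through_j[OF c] r wound_once_or_rev_rotate[of b' "j # M" "length c1" cs] by simp
  next
    case False
    then have sM: "set cs \<subseteq> set M" using sub by auto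
    show ?thesis
    proof (cases "\<exists>i\<in>set cs. \<exists>k\<in>set cs. b j i = -1 \<and> b j k = 1")
      case True
      then show ?thesis using cycle_two_types[OF cyc sM] by blast
    next
      case opp: False
      have "b j u * b j v \<ge> 0" if "u \<in> set cs" "v \<in> set cs" for u v
        using that opp nbr_cases[of u] nbr_cases[of v] sM by (smt (verit) mult_eq_0_iff subsetD zero_le_mult_iff)
      then show ?thesis using cycle_one_type[OF cyc sM] by blast
    qed
  qed
  then have "cyclically_good b' (j # M)" unfolding cyclically_good_def by blast
  then have "cyclically_good b' (rotate (length (j # ys)) ((j # ys) @ xs))"
    using dist by (intro cyclically_good_rotate) auto
  then show ?thesis unfolding rotate_append by simp
qed

end

section \<open>The invariant and properness\<close>

definition exchange :: "'v quiver \<Rightarrow> 'v \<Rightarrow> 'v \<Rightarrow> int" where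
  "exchange Q u v = int (arr Q u v) - int (arr Q v u)"

lemma skew_exchange: "skew (exchange Q)"
  by (simp add: skew_def exchange_def)

lemma arr_exchange: "quiver Q \<Longrightarrow> arr Q u v = nat (exchange Q u v)"
  unfolding quiver_def exchange_def
  by (metis diff_0 diff_zero int_minus nat_int nat_zminus_int of_nat_0 diff_0_eq_0)

lemma quiver_eqI:
  fixes Q Q' :: "'v quiver"
  assumes "quiver Q" and "quiver Q'" and "verts Q = verts Q'" and "exchange Q = exchange Q'"
  shows "Q = Q'"
proof -
  have "arr Q = arr Q'"
    using arr_exchange[OF assms(1)] arr_exchange[OF assms(2)] assms(4) by (intro ext) simp
  then show ?thesis using assms(3) by (cases Q; cases Q') simp
qed

lemma verts_mutate [simp]: "verts (mutate j Q) = verts Q"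
  by (simp add: mutate_def)

lemma exchange_mutate:
  assumes "quiver Q"
  shows "exchange (mutate j Q) = mu j (exchange Q)"
proof (intro ext)
  fix u v
  have a: "int (arr Q x y) = max 0 (exchange Q x y)" for x y
    using arr_exchange[OF assms, of x y] by simp
  have jj: "arr Q j j = 0" using assms by (simp add: quiver_def)
  define c where "c = reverse_at j (compose_paths j (arr Q))"
  have "exchange (mutate j Q) u v = int (c u v) - int (c v u)"
    by (simp add: exchange_def mutate_def cancel_2cycles_def c_def[symmetric])
  also have "\<dots> = mu j (exchange Q) u v"
  proof (cases "u = j \<or> v = j")
    case True
    then show ?thesis
      using jj by (auto simp: c_def reverse_at_def compose_paths_def mu_def exchange_def)
  next
    case False
    then show ?thesis
      by (simp add: c_def reverse_at_def compose_paths_def mu_def a[symmetric]) (simp add: exchange_def)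
  qed
  finally show "exchange (mutate j Q) u v = mu j (exchange Q) u v" .
qed

lemma quiver_mutate:
  assumes "quiver Q" and "j \<in> verts Q"
  shows "quiver (mutate j Q)"
proof -
  have "u \<in> verts Q \<and> v \<in> verts Q" if pos: "arr (mutate j Q) u v > 0" for u v
  proof (rule ccontr)
    have z: "arr Q x y = 0 \<and> arr Q y x = 0" if "x \<notin> verts Q" for x y
      using assms(1) that unfolding quiver_def by blast
    assume "\<not> ?thesis"
    then show False
      using pos z[of u] z[of v] assms(2)
      by (auto simp: mutate_def cancel_2cycles_def reverse_at_def compose_paths_def split: if_splits)
  qed
  moreover have "arr (mutate j Q) u v = 0 \<or> arr (mutate j Q) v u = 0" for u v
    by (auto simp: mutate_def cancel_2cycles_def)
  ultimately show ?thesis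
    using assms(1) unfolding quiver_def by (auto simp: mutate_def cancel_2cycles_def)
qed

lemma mu_mu: "skew b \<Longrightarrow> mu j (mu j b) = b"
proof (intro ext)
  fix u v assume b: "skew b"
  show "mu j (mu j b) u v = b u v"
    using skewD[OF b, of u j] skewD[OF b, of v j] by (auto simp: mu_def max_def)
qed

lemma mutate_mutate: "quiver Q \<Longrightarrow> j \<in> verts Q \<Longrightarrow> mutate j (mutate j Q) = (Q :: 'v quiver)"
  by (rule quiver_eqI) (simp_all add: quiver_mutate exchange_mutate mu_mu skew_exchange)

section \<open>The invariant and its stability\<close>

definition good_coq :: "'v coq \<Rightarrow> bool" where
  "good_coq = (\<lambda>(Q, \<sigma>). coq (Q, \<sigma>) \<and> positive (exchange Q) \<sigma> \<and> cyclically_good (exchange Q) \<sigma>)"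

lemma good_coq_rotate: "good_coq (Q, \<sigma>) \<Longrightarrow> good_coq (Q, rotate n \<sigma>)"
  unfolding good_coq_def coq_def
  using positive_rotate[OF skew_exchange] cyclically_good_rotate by auto

lemma good_coq_same: "good_coq C \<Longrightarrow> same_coq C C' \<Longrightarrow> good_coq C'"
  by (cases C; cases C') (auto simp: same_coq_def good_coq_rotate)

text \<open>If both \<open>u\<close> and \<open>v\<close> were on the cycle, they would head its
  increasing rotation and so be adjacent. Hence the cycle meets at most one of them and does not
  notice the swap.\<close>

lemma wound_once_swap:
  assumes d: "distinct (u # v # xs)" and b: "skew b" "b u v = 0"
    and cyc: "chordless_cycle b cs" and w: "wound_once b (u # v # xs) cs"
  shows "wound_once b (v # u # xs) cs"
proof -
  obtain p q where pq: "cs = p @ q" "sorted_wrt (precedes (u # v # xs)) (q @ p)"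
    and o: "cyclically_oriented b cs"
    using w unfolding wound_once_def by blast
  have c: "chordless_cycle b (q @ p)"
    using chordless_cycle_append_commute[OF b(1)] cyc pq by blast
  have dqp: "distinct (q @ p)" using chordless_cycle_distinct[OF c] .
  have "\<not> (u \<in> set (q @ p) \<and> v \<in> set (q @ p))"
  proof
    assume uv: "u \<in> set (q @ p) \<and> v \<in> set (q @ p)"
    obtain e1 e2 r where e: "q @ p = e1 # e2 # r"
      using chordless_cycle_length[OF c] by (metis Suc_le_length_iff numeral_3_eq_3)
    have "\<not> precedes (u # v # xs) x u" for x
      using d by (auto dest: precedes_in)
    then have "e1 = u" using uv pq(2) e by auto
    moreover have "precedes (u # v # xs) x v \<Longrightarrow> x = u" for x
      using d by (auto dest: precedes_in)
    then have "e2 = v" using uv pq(2) e d dqp \<open>e1 = u\<close> by auto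
    ultimately have "b u v \<noteq> 0" using c e by auto
    then show False using b by simp
  qed
  then have "sorted_wrt (precedes (v # u # xs)) (q @ p)"
    by (intro sorted_wrt_mono_rel[OF _ pq(2)]) auto
  then show ?thesis using pq(1) o unfolding wound_once_def by blast
qed

lemma good_coq_wiggle:
  assumes "good_coq C" and "wiggle C C'"
  shows "good_coq C'"
proof -
  obtain Q \<sigma> where C: "C = (Q, \<sigma>)" by (cases C)
  obtain n u v xs where n: "rotate n \<sigma> = u # v # xs" and C': "C' = (Q, v # u # xs)"
    and a: "arr Q u v = 0" "arr Q v u = 0"
    using assms(2) C unfolding wiggle_def by auto
  let ?b = "exchange Q"
  have g: "good_coq (Q, u # v # xs)"
    using good_coq_rotate[of Q \<sigma> n] assms(1) C n by simp
  have b0: "?b u v = 0" "?b v u = 0" using a by (simp_all add: exchange_def)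
  have d: "distinct (u # v # xs)" using g by (simp add: good_coq_def coq_def)
  have "positive ?b (v # u # xs)"
    using g b0 unfolding good_coq_def positive_def by (auto simp: algebra_simps)
  moreover have "cyclically_good ?b (v # u # xs)"
    unfolding cyclically_good_def
  proof (intro allI impI)
    fix cs assume cs: "chordless_cycle ?b cs" "set cs \<subseteq> set (v # u # xs)"
    then have "wound_once ?b (u # v # xs) cs \<or> wound_once ?b (u # v # xs) (rev cs)"
      using g unfolding good_coq_def cyclically_good_def by auto
    then show "wound_once ?b (v # u # xs) cs \<or> wound_once ?b (v # u # xs) (rev cs)"
      using wound_once_swap[OF d skew_exchange b0(1)] chordless_cycle_rev[OF skew_exchange cs(1)] cs(1)
      by blast
  qed
  ultimately show ?thesis
    using g C' by (auto simp: good_coq_def coq_def)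
qed

lemma good_coq_cut_mutate:
  assumes g: "good_coq (Q, j # xs @ ys)" and out: "Out Q j \<subseteq> set xs" and inn: "In Q j \<inter> set xs = {}"
  shows "good_coq (mutate j Q, xs @ j # ys)"
proof -
  have q: "quiver Q" and d: "distinct (j # xs @ ys)" and v: "verts Q = set (j # xs @ ys)"
    using g by (auto simp: good_coq_def coq_def)
  have jQ: "j \<in> verts Q" using v by simp
  have o: "arr Q v j = 0" if "v \<in> set xs" for v
    using that inn by (auto simp: In_def)
  have i: "arr Q j v = 0" if "v \<in> set ys" for v
    using that out d by (auto simp: Out_def)
  interpret proper_cut "exchange Q" j xs ys
    using g d o i by unfold_locales (auto simp: skew_exchange exchange_def[of Q j] good_coq_def)
  show ?thesis
    using pos' cyclically_good_mu quiver_mutate[OF q jQ] d v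
    by (auto simp: good_coq_def coq_def exchange_mutate[OF q])
qed

lemma good_coq_step: "good_coq C \<Longrightarrow> coq_step C C' \<Longrightarrow> good_coq C'"
proof -
  assume g: "good_coq C" and "coq_step C C'"
  then consider "same_coq C C'" | "wiggle C C'" | j where "proper_mutation j C C'"
    unfolding coq_step_def by blast
  then show ?thesis
  proof cases
    case 3
    obtain Q \<sigma> where C: "C = (Q, \<sigma>)" by (cases C)
    obtain n xs ys where n: "rotate n \<sigma> = j # xs @ ys" and C': "C' = (mutate j Q, xs @ j # ys)"
      and io: "Out Q j \<subseteq> set xs" "In Q j \<inter> set xs = {}"
      using 3 C unfolding proper_mutation_def by auto
    have "good_coq (Q, j # xs @ ys)"
      using good_coq_rotate[of Q \<sigma> n] g C n by simp
    then show ?thesis using good_coq_cut_mutate[OF _ io] C' by simp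
  qed (use g good_coq_same good_coq_wiggle in blast)+
qed

section \<open>Chains that obstruct properness, and wiggles in their absence\<close>

lemma induced_pathI:
  assumes "distinct p" and "successively (\<lambda>u v. b u v \<noteq> 0) p"
    and "\<And>p1 u r v p2. p = p1 @ u # r @ v # p2 \<Longrightarrow> r \<noteq> [] \<Longrightarrow> b u v = 0"
  shows "induced_path b p"
  using assms
proof (induction p)
  case (Cons x p)
  have "induced_path b p"
  proof (rule Cons.IH)
    show "b u v = 0" if "p = p1 @ u # r @ v # p2" "r \<noteq> []" for p1 u r v p2
      using Cons.prems(3)[of "x # p1" u r v p2] that by simp
  qed (use Cons.prems in \<open>auto simp: successively_Cons\<close>)
  moreover have "b x y \<noteq> 0 \<longleftrightarrow> y = hd p" if y: "y \<in> set p" for y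
  proof
    assume "b x y \<noteq> 0"
    obtain r p2 where r: "p = r @ y # p2" using y by (meson split_list)
    then have "r = []" using Cons.prems(3)[of "[]" x r y p2] \<open>b x y \<noteq> 0\<close> by auto
    then show "y = hd p" using r by simp
  next
    assume "y = hd p"
    then show "b x y \<noteq> 0" using Cons.prems(2) y by (auto simp: successively_Cons)
  qed
  ultimately show ?case using Cons.prems(1) by simp
qed simp

text \<open>A shortest increasing chain of adjacent vertices from an in-neighbour to an out-neighbour of
  \<open>j\<close> would close up to a chordless cycle through \<open>j\<close> that is not wound once.\<close>

lemma no_increasing_chain:
  assumes b: "skew b" and d: "distinct (j # \<tau>)" and good: "cyclically_good b (j # \<tau>)"
    and "p \<noteq> []" and "set p \<subseteq> set \<tau>" and "b (hd p) j > 0" and "b j (last p) > 0"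
    and "successively (\<lambda>u v. b u v \<noteq> 0 \<and> precedes \<tau> u v) p"
  shows False
  using assms(4-)
proof (induction "length p" arbitrary: p rule: less_induct)
  case less
  let ?R = "\<lambda>u v. b u v \<noteq> 0 \<and> precedes \<tau> u v"
  have d\<tau>: "distinct \<tau>" using d by simp
  have "transp (precedes \<tau>)" using precedes_trans[OF d\<tau>] by (auto intro: transpI)
  then have sorted: "sorted_wrt (precedes \<tau>) p"
    using less.prems(5) successively_conv_sorted_wrt unfolding successively_conj by blast
  have "distinct p"
  proof -
    have "sorted_wrt (\<noteq>) p"
      by (rule sorted_wrt_mono_rel[OF _ sorted]) (use precedes_irrefl[OF d\<tau>] in blast)
    then show ?thesis by (induction p) auto
  qed
  \<comment> \<open>An adjacency that skips \<open>r\<close> would give a shorter chain with the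
    same ends.\<close>
  moreover have "b u v = 0" if p: "p = p1 @ u # r @ v # p2" and r: "r \<noteq> []" for p1 u r v p2
  proof (rule ccontr)
    assume "b u v \<noteq> 0"
    moreover have "precedes \<tau> u v" using sorted p by (auto simp: sorted_wrt_append)
    ultimately have "successively ?R (p1 @ u # v # p2)"
      using less.prems(5) p by (auto simp: successively_append_iff successively_Cons)
    moreover have "hd (p1 @ u # v # p2) = hd p" "last (p1 @ u # v # p2) = last p"
      using p by (simp_all add: hd_append)
    moreover have "length (p1 @ u # v # p2) < length p" using p r by simp
    moreover have "set (p1 @ u # v # p2) \<subseteq> set \<tau>" using less.prems(2) p by auto
    ultimately show False
      using less.hyps[of "p1 @ u # v # p2"] less.prems by simp
  qed
  ultimately have ip: "induced_path b p"
    using less.prems(5) unfolding successively_conj by (intro induced_pathI) auto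
  \<comment> \<open>An inner out-neighbour of \<open>j\<close> would end a shorter chain, an inner
    in-neighbour would start one.\<close>
  have ends: "b j y \<noteq> 0 \<longleftrightarrow> y = hd p \<or> y = last p" if y: "y \<in> set p" for y
  proof
    assume "b j y \<noteq> 0"
    obtain p1 p2 where p: "p = p1 @ y # p2" using y by (meson split_list)
    have s: "successively ?R (y # p2)" "successively ?R (p1 @ [y])"
      using less.prems(5) p by (auto simp: successively_append_iff successively_Cons)
    show "y = hd p \<or> y = last p"
    proof (rule ccontr)
      assume ne: "\<not> ?thesis"
      then have p12: "p1 \<noteq> []" "p2 \<noteq> []" using p by auto
      show False
      proof (cases "b j y > 0")
        case True
        then show False
          using less.hyps[of "p1 @ [y]"] less.prems s p p12 by auto
      next
        case False
        then have "b y j > 0" using \<open>b j y \<noteq> 0\<close> skewD[OF b, of y j] by simp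
        then show False
          using less.hyps[of "y # p2"] less.prems s p p12 by auto
      qed
    qed
  next
    assume "y = hd p \<or> y = last p"
    then show "b j y \<noteq> 0" using less.prems skewD[OF b, of j "hd p"] by auto
  qed
  have "hd p \<noteq> last p" using less.prems skewD[OF b, of j "hd p"] by auto
  then have len: "2 \<le> length p" using less.prems(1)
    by (metis One_nat_def Suc_1 hd_Cons_tl last.simps length_0_conv length_tl not_less_eq_eq
        diff_is_0_eq)
  have "j \<notin> set p" using less.prems(2) d by auto
  then have cyc: "chordless_cycle b (j # p)" using ip ends len by simp
  show False
  proof (rule cyclically_good_cases[OF good cyc])
    show "set (j # p) \<subseteq> set (j # \<tau>)" using less.prems(2) by auto
  next
    assume "b j (hd p) > 0"
    then show False using less.prems(3) skewD[OF b, of j "hd p"] by simp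
  next
    \<comment> \<open>The orientation at \<open>j\<close> makes the cycle run along
      \<open>rev p\<close>, from the out-neighbour to the in-neighbour. It would have to increase in
      this direction, but \<open>p\<close> itself increases and has at least two vertices.\<close>
    assume w: "wound_once b (j # \<tau>) (j # rev p)"
    have "last (j # rev p) \<in> set \<tau>" using less.prems(1,2) by (auto simp: last_rev)
    then have "sorted_wrt (precedes (j # \<tau>)) (j # rev p)"
      by (intro wound_once_sorted[OF d w]) simp
    then have "sorted_wrt (precedes (j # \<tau>)) (rev p)" by simp
    then have "sorted_wrt (\<lambda>x y. precedes (j # \<tau>) y x) p" by (simp add: sorted_wrt_rev)
    moreover obtain h q where p: "p = h # q" using len by (cases p) auto
    moreover have "q \<noteq> []" using len p by auto
    moreover have "hd q \<in> set q" using \<open>q \<noteq> []\<close> by simp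
    ultimately have "precedes (j # \<tau>) (hd q) h" by simp
    moreover have "hd q \<in> set \<tau>" using \<open>hd q \<in> set q\<close> p less.prems(2) by auto
    then have "hd q \<noteq> j" using d by auto
    ultimately have "precedes \<tau> (hd q) h" by simp
    moreover have "precedes \<tau> h (hd q)" using sorted p \<open>q \<noteq> []\<close> by simp
    ultimately show False using precedes_asym[OF d\<tau>] by blast
  qed
qed

text \<open>One-directional, unlike \<open>wiggle_equivalent\<close>: \<open>good_coq\<close> is
  shown to persist along forward steps, and all rearrangements below consist of such steps.\<close>

definition rearranges :: "'v coq \<Rightarrow> 'v coq \<Rightarrow> bool" where
  "rearranges = (sup same_coq wiggle)\<^sup>*\<^sup>*"

lemma rearranges_refl [simp]: "rearranges C C"
  by (simp add: rearranges_def)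

lemma rearranges_trans [trans]: "rearranges C D \<Longrightarrow> rearranges D E \<Longrightarrow> rearranges C E"
  unfolding rearranges_def by (rule rtranclp_trans)

lemma rearranges_same: "same_coq C D \<Longrightarrow> rearranges C D"
  and rearranges_wiggle: "wiggle C D \<Longrightarrow> rearranges C D"
  unfolding rearranges_def by (auto intro: r_into_rtranclp)

lemma rearranges_rotate: "rearranges (Q, \<sigma>) (Q, rotate n \<sigma>)"
  by (intro rearranges_same) (auto simp: same_coq_def)

lemma rearranges_swap:
  assumes "arr Q u v = 0" and "arr Q v u = 0"
  shows "rearranges (Q, p @ u # v # q) (Q, p @ v # u # q)"
proof -
  have "rotate (length p) (p @ u # v # q) = u # v # q @ p" by (simp add: rotate_append)
  then have "wiggle (Q, p @ u # v # q) (Q, v # u # q @ p)"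
    using assms unfolding wiggle_def by blast
  then have "rearranges (Q, p @ u # v # q) (Q, v # u # q @ p)" by (rule rearranges_wiggle)
  also have "rearranges (Q, v # u # q @ p) (Q, p @ v # u # q)"
    using rearranges_rotate[of Q "(v # u # q) @ p" "length (v # u # q)"]
    unfolding rotate_append by simp
  finally show ?thesis .
qed

lemma rearranges_move:
  assumes "\<And>v. v \<in> set vs \<Longrightarrow> arr Q u v = 0 \<and> arr Q v u = 0"
  shows "rearranges (Q, p @ u # vs @ q) (Q, p @ vs @ u # q)"
  using assms
proof (induction vs arbitrary: p)
  case (Cons v vs)
  have "rearranges (Q, p @ u # v # vs @ q) (Q, p @ v # u # vs @ q)"
    using Cons.prems by (intro rearranges_swap) auto
  also have "rearranges (Q, p @ v # u # vs @ q) (Q, p @ v # vs @ u # q)"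
    using Cons.IH[of "p @ [v]"] Cons.prems by simp
  finally show ?case by simp
qed simp

text \<open>Working from the right, each entry in \<open>X\<close> has to pass only later entries
  outside \<open>X\<close>, and it is adjacent to none of them.\<close>

lemma rearranges_partition:
  assumes "\<And>u v. u \<in> X \<Longrightarrow> v \<notin> X \<Longrightarrow> precedes \<tau> u v \<Longrightarrow> arr Q u v = 0 \<and> arr Q v u = 0"
  shows "rearranges (Q, p @ \<tau>) (Q, p @ filter (\<lambda>v. v \<notin> X) \<tau> @ filter (\<lambda>v. v \<in> X) \<tau>)"
  using assms
proof (induction \<tau> arbitrary: p)
  case (Cons a \<tau>)
  have 1: "rearranges (Q, p @ a # \<tau>)
      (Q, p @ a # filter (\<lambda>v. v \<notin> X) \<tau> @ filter (\<lambda>v. v \<in> X) \<tau>)"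
    using Cons.IH[of "p @ [a]"] Cons.prems by simp
  show ?case
  proof (cases "a \<in> X")
    case True
    note 1
    also have "rearranges (Q, p @ a # filter (\<lambda>v. v \<notin> X) \<tau> @ filter (\<lambda>v. v \<in> X) \<tau>)
      (Q, p @ filter (\<lambda>v. v \<notin> X) \<tau> @ a # filter (\<lambda>v. v \<in> X) \<tau>)"
      using Cons.prems[of a] True by (intro rearranges_move) auto
    finally show ?thesis using True by simp
  qed (use 1 in simp)
qed simp

lemma rearranges_good: "rearranges C C' \<Longrightarrow> good_coq C \<Longrightarrow> good_coq C'"
  unfolding rearranges_def
  by (induction rule: rtranclp_induct) (auto intro: good_coq_same good_coq_wiggle)

text \<open>\<open>X\<close> collects the vertices reached from in-neighbours of \<open>j\<close> by
  chains of adjacent vertices that increase in the cut at \<open>j\<close>. It is closed under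
  further such steps, so wiggles can push it to the end, and \<open>no_increasing_chain\<close>
  keeps the out-neighbours of \<open>j\<close> out of it. \<open>F\<close> and \<open>G\<close> come
  in the shape that \<open>good_coq_cut_mutate\<close> expects.\<close>

lemma good_coq_proper_vertex:
  assumes g: "good_coq (Q, \<sigma>)" and j: "j \<in> verts Q"
  obtains F G where "rearranges (Q, \<sigma>) (Q, j # F @ G)" "proper_vertex (Q, j # F @ G) j"
    "Out Q j \<subseteq> set F" "In Q j \<inter> set F = {}"
proof -
  let ?b = "exchange Q"
  have q: "quiver Q" and v: "verts Q = set \<sigma>" using g by (auto simp: good_coq_def coq_def)
  obtain s1 s2 where s: "\<sigma> = s1 @ j # s2" using j v by (metis split_list)
  define \<tau> where "\<tau> = s2 @ s1"
  have r: "rotate (length s1) \<sigma> = j # \<tau>" by (simp add: s \<tau>_def rotate_append)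
  have g': "good_coq (Q, j # \<tau>)" using good_coq_rotate[OF g] r by metis
  have d: "distinct (j # \<tau>)" using g' by (simp add: good_coq_def coq_def)
  have in\<tau>: "In Q j \<subseteq> set \<tau>" and out\<tau>: "Out Q j \<subseteq> set \<tau>"
  proof -
    have "v \<in> set \<tau>" if "arr Q j v > 0 \<or> arr Q v j > 0" for v
    proof -
      have "v \<in> verts Q" "v \<noteq> j" using that q unfolding quiver_def by auto
      then show ?thesis using g' by (auto simp: good_coq_def coq_def)
    qed
    then show "In Q j \<subseteq> set \<tau>" "Out Q j \<subseteq> set \<tau>" by (auto simp: In_def Out_def)
  qed
  have pos: "?b u w > 0 \<longleftrightarrow> arr Q u w > 0" for u w
    using arr_exchange[OF q, of u w] by simp
  have zero: "arr Q u w = 0 \<and> arr Q w u = 0" if "?b u w = 0" for u w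
    using that arr_exchange[OF q, of u w] arr_exchange[OF q, of w u] skewD[OF skew_exchange, of Q w u]
    by simp
  define chain where "chain p \<longleftrightarrow> p \<noteq> [] \<and> set p \<subseteq> set \<tau> \<and> hd p \<in> In Q j
    \<and> successively (\<lambda>u v. ?b u v \<noteq> 0 \<and> precedes \<tau> u v) p" for p
  define X where "X = {u. \<exists>p. chain p \<and> last p = u}"
  define F where "F = filter (\<lambda>v. v \<notin> X) \<tau>"
  define G where "G = filter (\<lambda>v. v \<in> X) \<tau>"
  have inX: "In Q j \<subseteq> X"
  proof
    fix i assume "i \<in> In Q j"
    then have "chain [i]" using in\<tau> by (auto simp: chain_def)
    then show "i \<in> X" unfolding X_def by force
  qed
  have outX: "k \<notin> X" if k: "k \<in> Out Q j" for k
  proof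
    assume "k \<in> X"
    then obtain p where p: "chain p" "last p = k" by (auto simp: X_def)
    show False
    proof (rule no_increasing_chain[OF skew_exchange d])
      show "cyclically_good ?b (j # \<tau>)" using g' by (simp add: good_coq_def)
      show "?b (hd p) j > 0" using p by (auto simp: chain_def pos In_def)
      show "?b j (last p) > 0" using p k by (auto simp: pos Out_def)
    qed (use p in \<open>auto simp: chain_def\<close>)
  qed
  have closed: "w \<in> X" if uw: "u \<in> X" "precedes \<tau> u w" "?b u w \<noteq> 0" for u w
  proof -
    obtain p where p: "chain p" "last p = u" using uw(1) by (auto simp: X_def)
    then have "chain (p @ [w])"
      using uw precedes_in[OF uw(2)] by (auto simp: chain_def successively_append_iff)
    then show ?thesis unfolding X_def by force
  qed
  have "rearranges (Q, \<sigma>) (Q, j # \<tau>)" using rearranges_rotate[of Q \<sigma> "length s1"] r by simp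
  moreover have "rearranges (Q, [j] @ \<tau>) (Q, [j] @ F @ G)"
    unfolding F_def G_def using closed zero by (intro rearranges_partition) blast
  ultimately have 1: "rearranges (Q, \<sigma>) (Q, j # F @ G)"
    using rearranges_trans by fastforce
  have 2: "Out Q j \<subseteq> set F" using outX out\<tau> by (auto simp: F_def)
  have 3: "In Q j \<inter> set F = {}" using inX by (auto simp: F_def)
  have "right_turn (j # F @ G) i j k" if "i \<in> In Q j" "k \<in> Out Q j" for i k
  proof -
    have "i \<in> set G" using that inX in\<tau> by (auto simp: G_def)
    then obtain g1 g2 where G: "G = g1 @ i # g2" by (meson split_list)
    have "k \<in> set F" using that 2 by auto
    then obtain f1 f2 where F: "F = f1 @ k # f2" by (meson split_list)
    \<comment> \<open>Read from \<open>i\<close> on, the circle shows the rest of \<open>G\<close>,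
      then \<open>j\<close>, then \<open>F\<close> with \<open>k\<close> in it.\<close>
    have "rotate (length (j # F @ g1)) ((j # F @ g1) @ i # g2) = (i # g2) @ j # F @ g1"
      by (rule rotate_append)
    then have "rotate (length (j # F @ g1)) (j # F @ G) = [] @ [i] @ g2 @ [j] @ f1 @ [k] @ (f2 @ g1)"
      using F G by simp
    then show ?thesis unfolding right_turn_def by blast
  qed
  then have "proper_vertex (Q, j # F @ G) j" by (simp add: proper_vertex_def)
  then show ?thesis using that 1 2 3 by blast
qed

section \<open>Total properness, and transport of orderings along mutations\<close>

lemma good_coq_proper: "good_coq C \<Longrightarrow> proper_coq C"
proof -
  assume g: "good_coq C"
  obtain Q \<sigma> where C: "C = (Q, \<sigma>)" by (cases C)
  have "\<exists>C'. wiggle_equivalent C C' \<and> proper_vertex C' j" if j: "j \<in> verts Q" for j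
  proof -
    obtain F G where "rearranges (Q, \<sigma>) (Q, j # F @ G)" "proper_vertex (Q, j # F @ G) j"
      using good_coq_proper_vertex[of Q \<sigma> j] g C j by metis
    then show ?thesis
      using C unfolding wiggle_equivalent_def rearranges_def by (meson rtranclp_into_equivclp)
  qed
  then show ?thesis unfolding proper_coq_def C by simp
qed

lemma good_coq_totally_proper: "good_coq C \<Longrightarrow> totally_proper C"
proof -
  assume g: "good_coq C"
  have "good_coq C'" if "coq_step\<^sup>*\<^sup>* C C'" for C'
    using that by (induction rule: rtranclp_induct) (use g in \<open>auto intro: good_coq_step\<close>)
  then show ?thesis
    unfolding totally_proper_def proper_mutation_class_def using good_coq_proper by blast
qed

lemma good_coq_mutate:
  assumes "good_coq (Q, \<sigma>)" and "j \<in> verts Q"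
  shows "\<exists>\<sigma>'. good_coq (mutate j Q, \<sigma>')"
  using good_coq_proper_vertex[OF assms] rearranges_good[OF _ assms(1)] good_coq_cut_mutate
  by metis

text \<open>Transport runs backwards, from \<open>Q'\<close> to \<open>Q\<close>: mutating the later
  quiver at the same vertex undoes each step.\<close>

lemma good_coq_mutation_equivalent:
  assumes "mutation_equivalent Q Q'" and "quiver Q" and "\<exists>\<sigma>. good_coq (Q', \<sigma>)"
  shows "\<exists>\<sigma>. good_coq (Q, \<sigma>)"
  using assms(1)[unfolded mutation_equivalent_def] assms(2,3)
proof (induction rule: converse_rtranclp_induct)
  case (step Q Q1)
  then obtain j where j: "j \<in> verts Q" "Q1 = mutate j Q" by (auto simp: mutation_step_def)
  have "quiver Q1" using quiver_mutate[OF step.prems(1) j(1)] j(2) by simp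
  then obtain \<sigma> where "good_coq (Q1, \<sigma>)" using step.IH step.prems(2) by metis
  then show ?case
    using good_coq_mutate[of Q1 \<sigma> j] j(1) mutate_mutate[OF step.prems(1) j(1)]
    unfolding j(2) by simp
qed

section \<open>Dynkin quivers\<close>

text \<open>The unique smaller neighbour of \<open>a\<close>; only meaningful for \<open>a > 0\<close>.\<close>

fun parent :: "dynkin \<Rightarrow> nat \<Rightarrow> nat" where
  "parent (TypeA n) a = a - 1"
| "parent (TypeD n) a = (if a = n - 1 then n - 3 else a - 1)"
| "parent (TypeE n) a = (if a = n - 1 then 2 else a - 1)"

lemma parent_less: "dynkin_type t \<Longrightarrow> 0 < a \<Longrightarrow> parent t a < a"
  by (cases t) auto

text \<open>The numbering grows each diagram from vertex \<open>0\<close> by attaching leaves. Both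
  the recursion for the Cartan form and the ordering of the vertices rest on this.\<close>

lemma dynkin_edge_iff:
  assumes "dynkin_type t"
  shows "{a, a'} \<in> dynkin_edges t \<longleftrightarrow>
    0 < a' \<and> a' < rank t \<and> a = parent t a' \<or> 0 < a \<and> a < rank t \<and> a' = parent t a"
proof (cases t)
  case (TypeA n)
  have d: "{a, a'} \<in> dynkin_edges t \<longleftrightarrow> (a' = a + 1 \<and> a + 1 < n) \<or> (a = a' + 1 \<and> a' + 1 < n)"
    using TypeA by (auto simp: doubleton_eq_iff)
  have e: "(a' = a + 1 \<and> a + 1 < n) \<longleftrightarrow> 0 < a' \<and> a' < rank t \<and> a = parent t a'" for a a'
    using assms unfolding TypeA rank.simps parent.simps dynkin_type.simps by presburger
  show ?thesis using d e[of a' a] e[of a a'] by argo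
next
  case (TypeD n)
  have d: "{a, a'} \<in> dynkin_edges t \<longleftrightarrow>
      (a' = a + 1 \<and> a + 2 < n \<or> a = n - 3 \<and> a' = n - 1) \<or> (a = a' + 1 \<and> a' + 2 < n \<or> a' = n - 3 \<and> a = n - 1)"
    using TypeD by (auto simp: doubleton_eq_iff)
  have e: "(a' = a + 1 \<and> a + 2 < n \<or> a = n - 3 \<and> a' = n - 1) \<longleftrightarrow>
      0 < a' \<and> a' < rank t \<and> a = parent t a'" for a a'
    using assms unfolding TypeD rank.simps parent.simps dynkin_type.simps by presburger
  show ?thesis using d e[of a' a] e[of a a'] by argo
next
  case (TypeE n)
  have d: "{a, a'} \<in> dynkin_edges t \<longleftrightarrow>
      (a' = a + 1 \<and> a + 2 < n \<or> a = 2 \<and> a' = n - 1) \<or> (a = a' + 1 \<and> a' + 2 < n \<or> a' = 2 \<and> a = n - 1)"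
    using TypeE by (auto simp: doubleton_eq_iff)
  have e: "(a' = a + 1 \<and> a + 2 < n \<or> a = 2 \<and> a' = n - 1) \<longleftrightarrow>
      0 < a' \<and> a' < rank t \<and> a = parent t a'" for a a'
    using assms unfolding TypeE rank.simps parent.simps dynkin_type.simps insert_iff empty_iff by presburger
  show ?thesis using d e[of a' a] e[of a a'] by argo
qed

section \<open>Positivity of the Cartan forms\<close>

definition cartan :: "dynkin \<Rightarrow> nat \<Rightarrow> nat \<Rightarrow> int" where
  "cartan t a a' = (if a = a' then 2 else if {a, a'} \<in> dynkin_edges t then -1 else 0)"

definition cartan_form :: "dynkin \<Rightarrow> (nat \<Rightarrow> int) \<Rightarrow> nat \<Rightarrow> int" where
  "cartan_form t y m = (\<Sum>a<m. \<Sum>a'<m. cartan t a a' * y a * y a')"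

text \<open>For \<open>m > 0\<close>, vertex \<open>m\<close> is a leaf among the vertices up to
  \<open>m\<close>, so its new row and column each have a single off-diagonal entry -1.\<close>

lemma cartan_form_Suc:
  assumes "dynkin_type t" and "m < rank t"
  shows "cartan_form t y (Suc m)
    = cartan_form t y m + 2 * (y m)\<^sup>2 - (if m = 0 then 0 else 2 * y m * y (parent t m))"
proof -
  let ?S = "\<Sum>a<m. cartan t a m * y a * y m"
  have sym: "cartan t a a' = cartan t a' a" for a a'
    by (simp add: cartan_def insert_commute)
  have "(\<Sum>a'<m. cartan t m a' * y m * y a') = ?S"
    by (intro sum.cong) (auto simp: sym[of m])
  moreover have "cartan_form t y (Suc m) = cartan_form t y m + ?S
     + (\<Sum>a'<m. cartan t m a' * y m * y a') + cartan t m m * y m * y m"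
    by (simp add: cartan_form_def sum.distrib)
  moreover have "?S = (if m = 0 then 0 else - y m * y (parent t m))"
  proof (cases "m = 0")
    case False
    have "cartan t a m = (if a = parent t m then -1 else 0)" if "a < m" for a
      using that False assms dynkin_edge_iff[OF assms(1), of a m] parent_less[OF assms(1), of a]
      by (auto simp: cartan_def)
    then have "?S = (\<Sum>a<m. if a = parent t m then - y m * y a else 0)"
      by (intro sum.cong) auto
    also have "\<dots> = - y m * y (parent t m)"
      using parent_less[OF assms(1), of m] False by (simp add: sum.delta)
    finally show ?thesis using False by simp
  qed simp
  ultimately show ?thesis
    by (simp add: cartan_def power2_eq_square)
qed

text \<open>The Cartan form of a path is this plus \<open>(y k)\<^sup>2\<close>. The last square is
  left out so that it can be combined with the terms of whatever is attached at
  \<open>k\<close>.\<close>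

definition path_squares :: "(nat \<Rightarrow> int) \<Rightarrow> nat \<Rightarrow> int" where
  "path_squares y k = (y 0)\<^sup>2 + (\<Sum>i<k. (y i - y (Suc i))\<^sup>2)"

lemma path_squares_nonneg: "path_squares y k \<ge> 0"
  unfolding path_squares_def by (intro add_nonneg_nonneg sum_nonneg) auto

lemma path_squares_0: "path_squares y k \<le> 0 \<Longrightarrow> i \<le> k \<Longrightarrow> y i = 0"
proof (induction k arbitrary: i)
  case (Suc k)
  have e: "path_squares y (Suc k) = path_squares y k + (y k - y (Suc k))\<^sup>2"
    by (simp add: path_squares_def)
  have "path_squares y k \<le> 0" "(y k - y (Suc k))\<^sup>2 \<le> 0"
    using Suc.prems(1) path_squares_nonneg[of y k] zero_le_power2[of "y k - y (Suc k)"]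
    unfolding e by linarith+
  then show ?case using Suc.IH[of k] Suc.IH[of i] Suc.prems(2) by (cases "i = Suc k") auto
qed (simp add: path_squares_def)

lemma cartan_form_path:
  assumes "dynkin_type t" and "k < rank t" and "\<And>a. 0 < a \<Longrightarrow> a \<le> k \<Longrightarrow> parent t a = a - 1"
  shows "cartan_form t y (Suc k) = path_squares y k + (y k)\<^sup>2"
  using assms(2,3)
proof (induction k)
  case 0
  then show ?case
    using cartan_form_Suc[OF assms(1), of 0 y] by (simp add: cartan_form_def path_squares_def)
next
  case (Suc k)
  then have "cartan_form t y (Suc k) = path_squares y k + (y k)\<^sup>2" by simp
  then show ?case
    using cartan_form_Suc[OF assms(1), of "Suc k" y] Suc.prems
    by (simp add: path_squares_def power2_eq_square algebra_simps)
qed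

lemma cartan_form_pos:
  assumes t: "dynkin_type t" and y: "a < rank t" "y a \<noteq> 0"
  shows "cartan_form t y (rank t) > 0"
proof (rule ccontr)
  assume "\<not> ?thesis"
  then have le: "cartan_form t y (rank t) \<le> 0" by simp
  show False
  proof (cases t)
    case (TypeA n)
    then obtain k where k: "n = Suc k" using t by (cases n) auto
    have "path_squares y k + (y k)\<^sup>2 \<le> 0"
      using le cartan_form_path[OF t, of k y] TypeA k by simp
    then have "path_squares y k \<le> 0"
      using zero_le_power2[of "y k"] by linarith
    then show False using path_squares_0[of y k a] y TypeA k by simp
  next
    case (TypeD n)
    then obtain k where k: "n = Suc (Suc (Suc k))" "k \<ge> 1"
      using t that[of "n - 3"] by simp
    have 1: "cartan_form t y (Suc (Suc k)) = path_squares y k + (y k - y (Suc k))\<^sup>2 + (y (Suc k))\<^sup>2"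
      using cartan_form_path[OF t, of "Suc k" y] TypeD k by (simp add: path_squares_def)
    have 2: "cartan_form t y (rank t) = cartan_form t y (Suc (Suc k))
        + 2 * (y (Suc (Suc k)))\<^sup>2 - 2 * y (Suc (Suc k)) * y k"
      using cartan_form_Suc[OF t, of "Suc (Suc k)" y] TypeD k by simp
    \<comment> \<open>After doubling, two copies of \<open>(y k)\<^sup>2\<close> are left outside
      \<open>path_squares\<close>; each completes the square for one of the two short arms.\<close>
    have "2 * cartan_form t y (rank t) = 2 * path_squares y k + (y k - 2 * y (Suc k))\<^sup>2
        + (y k - 2 * y (Suc (Suc k)))\<^sup>2"
      unfolding 2 1 by (simp add: power2_eq_square algebra_simps)
    then have "2 * path_squares y k + (y k - 2 * y (Suc k))\<^sup>2 + (y k - 2 * y (Suc (Suc k)))\<^sup>2 \<le> 0"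
      using le by simp
    then have z: "path_squares y k \<le> 0" "(y k - 2 * y (Suc k))\<^sup>2 \<le> 0" "(y k - 2 * y (Suc (Suc k)))\<^sup>2 \<le> 0"
      using path_squares_nonneg[of y k] zero_le_power2[of "y k - 2 * y (Suc k)"]
        zero_le_power2[of "y k - 2 * y (Suc (Suc k))"] by linarith+
    have "y i = 0" if "i \<le> k" for i using path_squares_0[OF z(1) that] .
    moreover have "y (Suc k) = 0" "y (Suc (Suc k)) = 0" using z calculation[of k] by simp_all
    moreover have "a \<le> k \<or> a = Suc k \<or> a = Suc (Suc k)" using y TypeD k by auto
    ultimately show False using y by metis
  next
    case (TypeE n)
    \<comment> \<open>Squares completed along the three arms from the leaves inwards; \<open>E\<^sub>6\<close> and \<open>E\<^sub>7\<close> are the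
      restrictions of \<open>E\<^sub>8\<close> to a shorter long arm. In \<open>E\<^sub>8\<close> the coefficient \<open>1/30\<close> of the squared
      branch value is what remains of \<open>2\<close> (everything is scaled by \<open>60\<close>).\<close>
    let ?s = "\<lambda>x0 x1 z x3 x4 x5 x6 u. 30 * (2*x0 - x1)\<^sup>2 + 10 * (3*x1 - 2*z)\<^sup>2 + 30 * (2*u - z)\<^sup>2
       + 30 * (2*x6 - x5)\<^sup>2 + 10 * (3*x5 - 2*x4)\<^sup>2 + 5 * (4*x4 - 3*x3)\<^sup>2
       + 3 * (5*x3 - 4*z)\<^sup>2 + 2 * z\<^sup>2"
    \<comment> \<open>An arm of \<open>m\<close> vertices takes \<open>m / (m + 1)\<close> from the
      branch entry, and 2 - 1/2 - 2/3 - 4/5 = 1/30 is still positive. Hence \<open>z\<close>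
      vanishes, and the other squares carry this outwards along the arms.\<close>
    have zero: "x0 = 0 \<and> x1 = 0 \<and> z = 0 \<and> x3 = 0 \<and> x4 = 0 \<and> x5 = 0 \<and> x6 = 0 \<and> u = 0"
      if "?s x0 x1 z x3 x4 x5 x6 u \<le> 0" for x0 x1 z x3 x4 x5 x6 u :: int
    proof -
      note nn = zero_le_power2[of "2*x0 - x1"] zero_le_power2[of "3*x1 - 2*z"]
        zero_le_power2[of "2*u - z"] zero_le_power2[of "2*x6 - x5"] zero_le_power2[of "3*x5 - 2*x4"]
        zero_le_power2[of "4*x4 - 3*x3"] zero_le_power2[of "5*x3 - 4*z"] zero_le_power2[of z]
      have "z\<^sup>2 \<le> 0" "(5*x3 - 4*z)\<^sup>2 \<le> 0" "(4*x4 - 3*x3)\<^sup>2 \<le> 0" "(3*x5 - 2*x4)\<^sup>2 \<le> 0"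
        "(2*x6 - x5)\<^sup>2 \<le> 0" "(2*u - z)\<^sup>2 \<le> 0" "(3*x1 - 2*z)\<^sup>2 \<le> 0" "(2*x0 - x1)\<^sup>2 \<le> 0"
        using that nn by linarith+
      then show ?thesis by simp
    qed
    have 1: "cartan_form t y (Suc (n - 2)) = path_squares y (n - 2) + (y (n - 2))\<^sup>2"
      using TypeE t by (intro cartan_form_path) auto
    have 2: "cartan_form t y n = cartan_form t y (Suc (n - 2)) + 2 * (y (n - 1))\<^sup>2 - 2 * y (n - 1) * y 2"
      using cartan_form_Suc[OF t, of "n - 1" y] TypeE t by auto
    have 3: "cartan_form t y n = path_squares y (n - 2) + (y (n - 2))\<^sup>2
        + 2 * (y (n - 1))\<^sup>2 - 2 * y (n - 1) * y 2"
      using 1 2 by simp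
    have n: "n = 6 \<or> n = 7 \<or> n = 8" using TypeE t by auto
    then show False
    proof (elim disjE)
      assume n: "n = 6"
      have "60 * cartan_form t y n = ?s (y 0) (y 1) (y 2) (y 3) (y 4) 0 0 (y 5)"
        unfolding 3 unfolding n path_squares_def
        by (simp add: eval_nat_numeral power2_eq_square algebra_simps)
      then have "?s (y 0) (y 1) (y 2) (y 3) (y 4) 0 0 (y 5) \<le> 0" using le TypeE by simp
      note zero[OF this]
      moreover have "a \<in> {0, 1, 2, 3, 4, 5}" using y TypeE n by auto
      ultimately show False using y by auto
    next
      assume n: "n = 7"
      have "60 * cartan_form t y n = ?s (y 0) (y 1) (y 2) (y 3) (y 4) (y 5) 0 (y 6)"
        unfolding 3 unfolding n path_squares_def
        by (simp add: eval_nat_numeral power2_eq_square algebra_simps)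
      then have "?s (y 0) (y 1) (y 2) (y 3) (y 4) (y 5) 0 (y 6) \<le> 0" using le TypeE by simp
      note zero[OF this]
      moreover have "a \<in> {0, 1, 2, 3, 4, 5, 6}" using y TypeE n by auto
      ultimately show False using y by auto
    next
      assume n: "n = 8"
      have "60 * cartan_form t y n = ?s (y 0) (y 1) (y 2) (y 3) (y 4) (y 5) (y 6) (y 7)"
        unfolding 3 unfolding n path_squares_def
        by (simp add: eval_nat_numeral power2_eq_square algebra_simps)
      then have "?s (y 0) (y 1) (y 2) (y 3) (y 4) (y 5) (y 6) (y 7) \<le> 0" using le TypeE by simp
      note zero[OF this]
      moreover have "a \<in> {0, 1, 2, 3, 4, 5, 6, 7}" using y TypeE n by auto
      ultimately show False using y by auto
    qed
  qed
qed

lemma cartan_form_nonneg: "dynkin_type t \<Longrightarrow> cartan_form t y (rank t) \<ge> 0"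
proof (cases "\<exists>a<rank t. y a \<noteq> 0")
  case True
  assume "dynkin_type t"
  then show ?thesis using True cartan_form_pos less_imp_le by blast
qed (simp add: cartan_form_def)

section \<open>Forests and Dynkin quivers\<close>

lemma union_edges_iff:
  "{(c, a), (c', a')} \<in> union_edges ts
    \<longleftrightarrow> c = c' \<and> c < length ts \<and> {a, a'} \<in> dynkin_edges (ts ! c)"
proof
  assume "{(c, a), (c', a')} \<in> union_edges ts"
  then obtain d e where e: "{(c, a), (c', a')} = Pair d ` e" "d < length ts" "e \<in> dynkin_edges (ts ! d)"
    unfolding union_edges_def by blast
  then have "(c, a) \<in> Pair d ` e" "(c', a') \<in> Pair d ` e" by auto
  then have d: "d = c" "d = c'" by auto
  then have "Pair d ` e = Pair d ` {a, a'}" using e(1) by simp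
  moreover have "inj (Pair d)" by (simp add: inj_on_def)
  ultimately have "e = {a, a'}" using inj_image_eq_iff by metis
  then show "c = c' \<and> c < length ts \<and> {a, a'} \<in> dynkin_edges (ts ! c)" using e d by simp
next
  assume r: "c = c' \<and> c < length ts \<and> {a, a'} \<in> dynkin_edges (ts ! c)"
  then have "{(c, a), (c', a')} = Pair c ` {a, a'}" by simp
  then show "{(c, a), (c', a')} \<in> union_edges ts" using r unfolding union_edges_def by blast
qed

text \<open>Vertices are inserted by increasing \<open>h\<close>, so a new vertex has at most one
  neighbour among the earlier ones. It goes to the front or to the end of the list according to the
  direction of the arrow between them.\<close>

lemma forest_order:
  fixes h :: "'v \<Rightarrow> nat"
  assumes "skew b" and "finite V"
    and "\<And>u u' v. u \<in> V \<Longrightarrow> u' \<in> V \<Longrightarrow> v \<in> V \<Longrightarrow> b u v \<noteq> 0 \<Longrightarrow> b u' v \<noteq> 0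
      \<Longrightarrow> h u \<le> h v \<Longrightarrow> h u' \<le> h v \<Longrightarrow> u = u'"
  shows "\<exists>\<sigma>. distinct \<sigma> \<and> set \<sigma> = V \<and> (\<forall>u\<in>V. \<forall>v\<in>V. b u v > 0 \<longrightarrow> precedes \<sigma> u v)"
  using assms(2,3)
proof (induction V rule: finite_ranking_induct[where f = h])
  case (insert x S)
  obtain \<sigma> where \<sigma>: "distinct \<sigma>" "set \<sigma> = S" "\<forall>u\<in>S. \<forall>v\<in>S. b u v > 0 \<longrightarrow> precedes \<sigma> u v"
    using insert.IH insert.prems by (metis insertCI)
  have sk: "b u x = - b x u" for u using skewD[OF assms(1)] .
  have xx: "b x x = 0" using skew_diag[OF assms(1)] .
  show ?case
  proof (cases "x \<in> S")
    case False
    show ?thesis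
    proof (cases "\<exists>u\<in>S. b x u > 0")
      case True
      then obtain u where u: "u \<in> S" "b x u > 0" by blast
      have ux: "b u x < 0" using u(2) sk[of u] by linarith
      have "b v x \<le> 0" if v: "v \<in> S" for v
      proof (rule ccontr)
        assume vx: "\<not> b v x \<le> 0"
        have "v = u"
          by (rule insert.prems[of v u x]) (use insert.hyps(2) u(1) v ux vx in auto)
        then show False using ux vx by simp
      qed
      then show ?thesis
        using \<sigma> False xx by (intro exI[of _ "x # \<sigma>"]) (auto simp: not_less[symmetric])
    next
      case none: False
      then show ?thesis
        using \<sigma> False xx by (intro exI[of _ "\<sigma> @ [x]"]) (auto simp: precedes_append)
    qed
  next
    case True
    then show ?thesis using \<sigma> by (metis insert_absorb)
  qed
qed simp

text \<open>A highest vertex of the cycle would have two distinct neighbours that are not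
  higher.\<close>

lemma forest_no_cycle:
  fixes h :: "'v \<Rightarrow> nat"
  assumes b: "skew b" and cyc: "chordless_cycle b cs" and sub: "set cs \<subseteq> V"
    and h: "\<And>u u' v. u \<in> V \<Longrightarrow> u' \<in> V \<Longrightarrow> v \<in> V \<Longrightarrow> b u v \<noteq> 0 \<Longrightarrow> b u' v \<noteq> 0
      \<Longrightarrow> h u \<le> h v \<Longrightarrow> h u' \<le> h v \<Longrightarrow> u = u'"
  shows False
proof -
  have ne: "set cs \<noteq> {}" using cyc by auto
  define m where "m = Max (h ` set cs)"
  have "m \<in> h ` set cs" using ne by (simp add: m_def)
  then obtain v where v: "v \<in> set cs" "h v = m" by blast
  have max: "h u \<le> h v" if "u \<in> set cs" for u using that v by (simp add: m_def)
  obtain c1 c2 where "cs = c1 @ v # c2" using v(1) by (meson split_list)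
  then have r: "rotate (length c1) cs = v # c2 @ c1" by (simp add: rotate_append)
  define p where "p = c2 @ c1"
  have c: "chordless_cycle b (v # p)"
    using chordless_cycle_rotate[OF b cyc] r unfolding p_def by metis
  have s: "set cs = insert v (set p)" using r unfolding p_def by (metis list.simps(15) set_rotate)
  have "p \<noteq> []" using c by auto
  then have hp: "hd p \<in> set p" "last p \<in> set p" by auto
  then have "b v (hd p) \<noteq> 0" "b v (last p) \<noteq> 0" using c by auto
  then have "hd p = last p"
    using hp s sub max v skewD[OF b, of v] by (intro h[of _ _ v]) auto
  moreover have "distinct p" using chordless_cycle_distinct[OF c] by simp
  ultimately show False using c by (cases p) (auto split: if_splits)
qed

lemma dynkin_orientation_good:
  fixes Q :: "'v quiver"
  assumes "dynkin_orientation Q"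
  shows "\<exists>\<sigma>. good_coq (Q, \<sigma>)"
proof -
  obtain ts f where q: "quiver Q" and ts: "\<forall>t\<in>set ts. dynkin_type t"
    and bij: "bij_betw f (verts Q) (union_verts ts)"
    and edges: "\<And>u v. u \<in> verts Q \<Longrightarrow> v \<in> verts Q \<Longrightarrow>
          arr Q u v + arr Q v u = (if {f u, f v} \<in> union_edges ts then 1 else 0)"
    using assms unfolding dynkin_orientation_def by blast
  let ?b = "exchange Q" and ?V = "verts Q"
  have adj: "?b u v \<noteq> 0 \<longleftrightarrow> {f u, f v} \<in> union_edges ts" and b1: "\<bar>?b u v\<bar> \<le> 1"
    if "u \<in> ?V" "v \<in> ?V" for u v
  proof -
    have "arr Q u v = 0 \<or> arr Q v u = 0" using q by (simp add: quiver_def)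
    then show "?b u v \<noteq> 0 \<longleftrightarrow> {f u, f v} \<in> union_edges ts" "\<bar>?b u v\<bar> \<le> 1"
      using edges[OF that] by (auto simp: exchange_def split: if_splits)
  qed
  have inj: "f u = f v \<Longrightarrow> u = v" if "u \<in> ?V" "v \<in> ?V" for u v
    using bij that by (meson bij_betw_def inj_onD)
  have fin: "finite ?V" using q by (simp add: quiver_def)
  \<comment> \<open>The position within the component. Equal values in different components do no
    harm, as only adjacent vertices get compared.\<close>
  define h where "h = (\<lambda>v. snd (f v))"
  have lower: "fst (f u) = fst (f v) \<and> snd (f u) = parent (ts ! fst (f v)) (snd (f v))"
    if uv: "u \<in> ?V" "v \<in> ?V" "?b u v \<noteq> 0" "h u \<le> h v" for u v
  proof -
    obtain c a c' a' where f: "f u = (c, a)" "f v = (c', a')" by (metis surj_pair)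
    have e: "c = c'" "c < length ts" "{a, a'} \<in> dynkin_edges (ts ! c)"
      using adj[OF uv(1,2)] uv(3) f union_edges_iff by auto
    have t: "dynkin_type (ts ! c)" using ts e by simp
    have "a \<le> a'" using uv(4) f by (simp add: h_def)
    then have "a = parent (ts ! c) a'"
      using e(3) parent_less[OF t, of a] unfolding dynkin_edge_iff[OF t] by auto
    then show ?thesis using f e by simp
  qed
  have forest: "u = u'"
    if "u \<in> ?V" "u' \<in> ?V" "v \<in> ?V" "?b u v \<noteq> 0" "?b u' v \<noteq> 0" "h u \<le> h v" "h u' \<le> h v" for u u' v
    using lower[of u v] lower[of u' v] that by (intro inj prod_eqI) auto
  obtain \<sigma> where d: "distinct \<sigma>" and s: "set \<sigma> = ?V"
    and top: "\<And>u v. u \<in> ?V \<Longrightarrow> v \<in> ?V \<Longrightarrow> ?b u v > 0 \<Longrightarrow> precedes \<sigma> u v"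
    using forest_order[OF skew_exchange fin, of Q h] forest by blast
  \<comment> \<open>All arrows increase along \<sigma>, so an adjacent pair gets -1 whichever way
    its arrow points: this is the Cartan matrix of the union.\<close>
  have gram: "gram ?b \<sigma> u v = (if f u = f v then 2 else if {f u, f v} \<in> union_edges ts then -1 else 0)"
    if "u \<in> ?V" "v \<in> ?V" for u v
  proof (cases "?b u v = 0 \<or> u = v")
    case True
    then show ?thesis using adj[OF that] inj[OF that] by (auto simp: gram_def)
  next
    case False
    then have "f u \<noteq> f v" "{f u, f v} \<in> union_edges ts" using adj[OF that] inj[OF that] by auto
    moreover have "?b v u = - ?b u v" using skewD[OF skew_exchange] .
    moreover have "precedes \<sigma> v u \<Longrightarrow> \<not> precedes \<sigma> u v" using precedes_asym[OF d] .
    moreover have "?b u v = 1 \<or> ?b u v = -1" using False b1[OF that] by linarith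
    ultimately show ?thesis
      using False top[OF that] top[OF that(2,1)] by (auto simp: gram_def)
  qed
  have "positive ?b \<sigma>"
    unfolding positive_def
  proof (intro allI impI)
    fix x :: "'v \<Rightarrow> int"
    assume "\<exists>v\<in>set \<sigma>. x v \<noteq> 0"
    then obtain v where v: "v \<in> ?V" "x v \<noteq> 0" using s by blast
    define z where "z = (\<lambda>p. x (inv_into ?V f p))"
    have z: "z (f u) = x u" if "u \<in> ?V" for u
      using that bij by (simp add: z_def bij_betw_inv_into_left)
    define g where "g = (\<lambda>p p'. (if p = p' then 2 else if {p, p'} \<in> union_edges ts then -1 else 0) * z p * z p')"
    let ?C = "{..<length ts}" and ?r = "\<lambda>c. {..<rank (ts ! c)}"
    have U: "union_verts ts = (SIGMA c:?C. ?r c)" by (auto simp: union_verts_def)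
    have SU: "(\<Sum>p\<in>union_verts ts. F p) = (\<Sum>c\<in>?C. \<Sum>a\<in>?r c. F (c, a))"
      for F :: "nat \<times> nat \<Rightarrow> int"
      unfolding U by (simp add: sum.Sigma)
    have "2 * tits ?b \<sigma> x = (\<Sum>u\<in>?V. \<Sum>v\<in>?V. g (f u) (f v))"
      unfolding tits_gram[OF skew_exchange d] s
      by (intro sum.cong refl) (simp add: g_def gram z)
    also have "\<dots> = (\<Sum>p\<in>union_verts ts. \<Sum>p'\<in>union_verts ts. g p p')"
      by (simp add: sum.reindex_bij_betw[OF bij] sum.reindex_bij_betw[OF bij, of "\<lambda>p. \<Sum>p'\<in>union_verts ts. g p p'"])
    also have "\<dots> = (\<Sum>c\<in>?C. \<Sum>a\<in>?r c. \<Sum>p'\<in>union_verts ts. g (c, a) p')"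
      by (rule SU)
    also have "\<dots> = (\<Sum>c\<in>?C. cartan_form (ts ! c) (\<lambda>a. z (c, a)) (rank (ts ! c)))"
    proof (intro sum.cong refl)
      fix c assume c: "c \<in> ?C"
      have "(\<Sum>p'\<in>union_verts ts. g (c, a) p')
        = (\<Sum>a'\<in>?r c. cartan (ts ! c) a a' * z (c, a) * z (c, a'))" for a
      proof -
        have "(\<Sum>p'\<in>union_verts ts. g (c, a) p') = (\<Sum>c'\<in>?C. \<Sum>a'\<in>?r c'. g (c, a) (c', a'))"
          by (rule SU)
        \<comment> \<open>Different components are not joined, so only the diagonal block
          contributes.\<close>
        also have "\<dots> = (\<Sum>c'\<in>{c}. \<Sum>a'\<in>?r c'. g (c, a) (c', a'))"
          using c by (intro sum.mono_neutral_right) (auto simp: g_def union_edges_iff)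
        also have "\<dots> = (\<Sum>a'\<in>?r c. cartan (ts ! c) a a' * z (c, a) * z (c, a'))"
          using c by (auto intro!: sum.cong simp: g_def union_edges_iff cartan_def)
        finally show ?thesis .
      qed
      then show "(\<Sum>a\<in>?r c. \<Sum>p'\<in>union_verts ts. g (c, a) p')
          = cartan_form (ts ! c) (\<lambda>a. z (c, a)) (rank (ts ! c))"
        by (simp add: cartan_form_def)
    qed
    finally have eq: "2 * tits ?b \<sigma> x
        = (\<Sum>c\<in>?C. cartan_form (ts ! c) (\<lambda>a. z (c, a)) (rank (ts ! c)))" .
    obtain c a where f: "f v = (c, a)" by fastforce
    have "(c, a) \<in> union_verts ts" using bij v(1) f by (metis bij_betwE)
    then have ca: "c < length ts" "a < rank (ts ! c)" by (auto simp: union_verts_def)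
    have "cartan_form (ts ! c) (\<lambda>a. z (c, a)) (rank (ts ! c)) > 0"
      using ts ca z[OF v(1)] v(2) f by (intro cartan_form_pos[of _ a]) auto
    then have "(\<Sum>c\<in>?C. cartan_form (ts ! c) (\<lambda>a. z (c, a)) (rank (ts ! c))) > 0"
      using ca ts by (intro sum_pos2[of _ c]) (auto intro: cartan_form_nonneg)
    then show "tits ?b \<sigma> x > 0" using eq by linarith
  qed
  moreover have "cyclically_good ?b \<sigma>"
    unfolding cyclically_good_def s using forest_no_cycle[OF skew_exchange, of Q _ ?V h] forest by blast
  ultimately show ?thesis
    using q d s by (auto simp: good_coq_def coq_def)
qed

theorem theorem15p3:
  fixes Q :: "'v quiver"
  assumes "quiver Q" and "finite_type Q"
  shows "\<exists>\<sigma>. coq (Q, \<sigma>) \<and> totally_proper (Q, \<sigma>)"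
proof -
  obtain Q' where "mutation_equivalent Q Q'" and "dynkin_orientation Q'"
    using assms(2) unfolding finite_type_def by blast
  then obtain \<sigma> where "good_coq (Q, \<sigma>)"
    using good_coq_mutation_equivalent[OF _ assms(1)] dynkin_orientation_good by blast
  then show ?thesis
    using good_coq_totally_proper by (auto simp: good_coq_def)
qed

end
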